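(* Let $(\mathfrak g=\mathfrak g_{\bar 0}\oplus\mathfrak g_{\bar 1},B)$ be an $8$-dimensional complex odd-quadratic Lie superalgebra of weak filiform type. Then $\mathfrak g$ is isomorphic to one of the following pairwise non-isomorphic Lie superalgebras $\mathfrak g_8^0$, $\mathfrak g_8^1$, $\mathfrak g_8^2$, given in a suitable basis $\{X_1,X_2,X_3,X_4,e_4,e_3,u_2,v_2\}$, with $X_1,\dots,X_4$ even and $e_4,e_3,u_2,v_2$ odd, by the following non-zero bracket products (skew-symmetric, except those of two odd vectors, which are symmetric). $\mathfrak g_8^0$: $[X_1,X_2]=X_3$, $[X_1,X_3]=X_4$, $[X_1,e_3]=u_2$, $[X_2,e_3]=v_2$, $[X_1,e_4]=e_3$, $[X_3,e_4]=-v_2$. $\mathfrak g_8^1$: $[X_1,X_2]=X_3$, $[X_1,X_3]=X_4$, $[X_1,e_3]=u_2$, $[X_2,e_3]=v_2$, $[X_1,e_4]=e_3$, $[X_3,e_4]=-v_2$, $[e_4,e_4]=X_4$. $\mathfrak g_8^2$: $[X_1,X_2]=X_3$, $[X_1,X_3]=X_4$, $[X_1,e_3]=u_2$, $[X_2,e_3]=v_2$, $[X_1,e_4]=e_3$, $[X_3,e_4]=-v_2$, $[e_4,e_4]=X_2$, $[e_3,e_4]=\frac12X_3$, $[e_3,e_3]=-\frac12X_4$, $[u_2,e_4]=X_4$. Moreover, in the three cases, the only possible non-zero values of $B$ are determined by $$B(X_1,v_2)=\lambda,\quad B(X_2,u_2)=-\lambda,\quad B(X_3,e_3)=\lambda,\quad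 B(X_4,e_4)=-\lambda,\quad B(X_1,e_4)=\alpha,\quad B(X_2,e_4)=\beta,$$ with $\lambda\neq0$ and $\alpha,\beta\in\mathbb C$.
   Context: A Lie superalgebra $\mathfrak g=\mathfrak g_{\bar 0}\oplus\mathfrak g_{\bar 1}$ is odd-quadratic, written $(\mathfrak g,B)$, if it carries a bilinear form $B$ with values in the ground field (here $\mathbb C$) that is supersymmetric ($B(X,Y)=(-1)^{ij}B(Y,X)$ for $X\in\mathfrak g_{\bar i},Y\in\mathfrak g_{\bar j}$), invariant ($B([X,Y],Z)=B(X,[Y,Z])$), odd ($B(\mathfrak g_{\bar 0},\mathfrak g_{\bar 0})=B(\mathfrak g_{\bar 1},\mathfrak g_{\bar 1})=0$) and non-degenerate; then $\dim\mathfrak g_{\bar 0}=\dim\mathfrak g_{\bar 1}$. A Lie superalgebra $\mathfrak g$ with $\dim\mathfrak g_{\bar 1}=m>0$ is of weak filiform type if there is a flag of subspaces $\mathfrak g_{\bar 1}=V_m\supset V_{m-1}\supset\dots\supset V_2\supset V_1=\{0\}$ with $\dim V_i=i$ and $[\mathfrak g_{\bar 0},V_i]=V_{i-1}$ for all $i\in\{2,\dots,m\}$, where $[\mathfrak g_{\bar 0},V_i]$ denotes the linear span of brackets (the flag jumps from dimension $2$ to dimension $0$). *)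

theory Defs
  imports "HOL-Analysis.Analysis" "HOL-Library.Z2"
begin

text \<open>
  Gradings are indexed by the two-element field \<open>bit\<close>: \<open>G 0\<close> is the even part and \<open>G 1\<close> the odd part.
  \<open>koszul i j\<close> is the sign $(-1)^{ij}$.
\<close>

definition koszul :: "bit \<Rightarrow> bit \<Rightarrow> complex" where
  "koszul i j = (if i = 1 \<and> j = 1 then -1 else 1)"

locale lie_superalgebra = vector_space scl
  for scl :: "complex \<Rightarrow> 'a::ab_group_add \<Rightarrow> 'a" +
  fixes G :: "bit \<Rightarrow> 'a set"
    and brk :: "'a \<Rightarrow> 'a \<Rightarrow> 'a"
  assumes subspace_G: "subspace (G i)"
    and G_disjoint: "G 0 \<inter> G 1 = {0}"
    and G_spanning: "\<exists>y\<in>G 0. \<exists>z\<in>G 1. x = y + z"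
    and brk_linear_left: "Vector_Spaces.linear scl scl (\<lambda>x. brk x y)"
    and brk_linear_right: "Vector_Spaces.linear scl scl (brk x)"
    and brk_graded: "x \<in> G i \<Longrightarrow> y \<in> G j \<Longrightarrow> brk x y \<in> G (i + j)"
    and brk_superskew: "x \<in> G i \<Longrightarrow> y \<in> G j \<Longrightarrow> brk x y = scl (- koszul i j) (brk y x)"
    and super_jacobi: "x \<in> G i \<Longrightarrow> y \<in> G j \<Longrightarrow> z \<in> G k \<Longrightarrow>
      brk x (brk y z) = brk (brk x y) z + scl (koszul i j) (brk y (brk x z))"

locale odd_quadratic_lie_superalgebra = lie_superalgebra scl G brk
  for scl :: "complex \<Rightarrow> 'a::ab_group_add \<Rightarrow> 'a"
    and G :: "bit \<Rightarrow> 'a set"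
    and brk :: "'a \<Rightarrow> 'a \<Rightarrow> 'a" +
  fixes B :: "'a \<Rightarrow> 'a \<Rightarrow> complex"
  assumes form_linear_left: "Vector_Spaces.linear scl (*) (\<lambda>x. B x y)"
    and form_linear_right: "Vector_Spaces.linear scl (*) (B x)"
    and form_supersymmetric: "x \<in> G i \<Longrightarrow> y \<in> G j \<Longrightarrow> B x y = koszul i j * B y x"
    and form_invariant: "B (brk x y) z = B x (brk y z)"
    and form_odd: "x \<in> G i \<Longrightarrow> y \<in> G i \<Longrightarrow> B x y = 0"
    and form_nondegenerate: "(\<And>y. B x y = 0) \<Longrightarrow> x = 0"

text \<open>
  \<open>dim\<close> is 0 for an infinite-dimensional subspace, so \<open>dim (G 1) > 0\<close> includes that the odd part
  has finite dimension. The condition on \<open>dim (V i)\<close> is imposed for \<open>i \<ge> 2\<close> only, since \<open>V 1 = {0}\<close>.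
\<close>

locale weak_filiform_lie_superalgebra = lie_superalgebra scl G brk
  for scl :: "complex \<Rightarrow> 'a::ab_group_add \<Rightarrow> 'a"
    and G :: "bit \<Rightarrow> 'a set"
    and brk :: "'a \<Rightarrow> 'a \<Rightarrow> 'a" +
  assumes odd_part_nontrivial: "dim (G 1) > 0"
    and weak_filiform_flag:
      "\<exists>V :: nat \<Rightarrow> 'a set.
         V (dim (G 1)) = G 1 \<and> V 1 = {0} \<and>
         (\<forall>i\<in>{2..dim (G 1)}.
            subspace (V i) \<and> dim (V i) = i \<and> V (i - 1) \<subset> V i \<and>
            span {brk x v | x v. x \<in> G 0 \<and> v \<in> V i} = V (i - 1))"

text \<open>Isomorphisms preserve the grading.\<close>

definition lie_superalgebra_iso ::
  "(complex \<Rightarrow> 'a::ab_group_add \<Rightarrow> 'a) \<Rightarrow> (bit \<Rightarrow> 'a set) \<Rightarrow> ('a \<Rightarrow> 'a \<Rightarrow> 'a) \<Rightarrow>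
   (complex \<Rightarrow> 'b::ab_group_add \<Rightarrow> 'b) \<Rightarrow> (bit \<Rightarrow> 'b set) \<Rightarrow> ('b \<Rightarrow> 'b \<Rightarrow> 'b) \<Rightarrow>
   ('a \<Rightarrow> 'b) \<Rightarrow> bool" where
  "lie_superalgebra_iso scl G brk scl' G' brk' f \<longleftrightarrow>
     Vector_Spaces.linear scl scl' f \<and> bij f \<and>
     (\<forall>i. f ` G i = G' i) \<and> (\<forall>x y. f (brk x y) = brk' (f x) (f y))"

definition lie_superalgebra_isomorphic ::
  "(complex \<Rightarrow> 'a::ab_group_add \<Rightarrow> 'a) \<Rightarrow> (bit \<Rightarrow> 'a set) \<Rightarrow> ('a \<Rightarrow> 'a \<Rightarrow> 'a) \<Rightarrow>
   (complex \<Rightarrow> 'b::ab_group_add \<Rightarrow> 'b) \<Rightarrow> (bit \<Rightarrow> 'b set) \<Rightarrow> ('b \<Rightarrow> 'b \<Rightarrow> 'b) \<Rightarrow> bool" where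
  "lie_superalgebra_isomorphic scl G brk scl' G' brk' \<longleftrightarrow>
     (\<exists>f. lie_superalgebra_iso scl G brk scl' G' brk' f)"

text \<open>
  The algebras $\mathfrak g_8^k$ share the graded space \<open>complex ^ gen\<close>, with scalar
  multiplication \<open>(*s)\<close>; the elements of \<open>gen\<close> label its standard basis.
\<close>

datatype gen = X1 | X2 | X3 | X4 | E4 | E3 | U2 | V2

lemma UNIV_gen: "UNIV = {X1, X2, X3, X4, E4, E3, U2, V2}"
  using gen.exhaust by auto

instance gen :: finite
  by standard (simp add: UNIV_gen)

fun parity :: "gen \<Rightarrow> bit" where
  "parity X1 = 0" | "parity X2 = 0" | "parity X3 = 0" | "parity X4 = 0"
| "parity E4 = 1" | "parity E3 = 1" | "parity U2 = 1" | "parity V2 = 1"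

definition grading8 :: "bit \<Rightarrow> (complex ^ gen) set" where
  "grading8 i = {x. \<forall>a. x $ a \<noteq> 0 \<longrightarrow> parity a = i}"

abbreviation bv :: "gen \<Rightarrow> complex ^ gen" where
  "bv a \<equiv> axis a 1"

text \<open>
  A multiplication table lists each non-zero product of basis vectors in one order only. The other
  order is supplied by super-skew-symmetry, and unlisted products vanish.
\<close>

definition table_product :: "((gen \<times> gen) \<times> (complex ^ gen)) list \<Rightarrow> gen \<Rightarrow> gen \<Rightarrow> complex ^ gen" where
  "table_product T a b =
     (case map_of T (a, b) of
        Some v \<Rightarrow> v
      | None \<Rightarrow> (case map_of T (b, a) of
          Some v \<Rightarrow> (- koszul (parity a) (parity b)) *s v
        | None \<Rightarrow> 0))"

definition table_bracket ::
  "((gen \<times> gen) \<times> (complex ^ gen)) list \<Rightarrow> complex ^ gen \<Rightarrow> complex ^ gen \<Rightarrow> complex ^ gen" where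
  "table_bracket T x y = (\<Sum>a\<in>UNIV. \<Sum>b\<in>UNIV. (x $ a * y $ b) *s table_product T a b)"

definition g80 :: "complex ^ gen \<Rightarrow> complex ^ gen \<Rightarrow> complex ^ gen" where
  "g80 = table_bracket
     [((X1, X2), bv X3), ((X1, X3), bv X4), ((X1, E3), bv U2),
      ((X2, E3), bv V2), ((X1, E4), bv E3), ((X3, E4), - bv V2)]"

definition g81 :: "complex ^ gen \<Rightarrow> complex ^ gen \<Rightarrow> complex ^ gen" where
  "g81 = table_bracket
     [((X1, X2), bv X3), ((X1, X3), bv X4), ((X1, E3), bv U2),
      ((X2, E3), bv V2), ((X1, E4), bv E3), ((X3, E4), - bv V2),
      ((E4, E4), bv X4)]"

definition g82 :: "complex ^ gen \<Rightarrow> complex ^ gen \<Rightarrow> complex ^ gen" where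
  "g82 = table_bracket
     [((X1, X2), bv X3), ((X1, X3), bv X4), ((X1, E3), bv U2),
      ((X2, E3), bv V2), ((X1, E4), bv E3), ((X3, E4), - bv V2),
      ((E4, E4), bv X2), ((E3, E4), (1/2) *s bv X3), ((E3, E3), (-1/2) *s bv X4),
      ((U2, E4), bv X4)]"

text \<open>
  Supersymmetry is plain symmetry on an even and an odd vector, so the listed
  values of the form extend symmetrically.
\<close>

definition form_value :: "complex \<Rightarrow> complex \<Rightarrow> complex \<Rightarrow> gen \<Rightarrow> gen \<Rightarrow> complex" where
  "form_value lam \<alpha> \<beta> a b =
     (let T = [((X1, V2), lam), ((X2, U2), - lam), ((X3, E3), lam), ((X4, E4), - lam),
               ((X1, E4), \<alpha>), ((X2, E4), \<beta>)]
      in case map_of T (a, b) of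
           Some c \<Rightarrow> c
         | None \<Rightarrow> (case map_of T (b, a) of Some c \<Rightarrow> c | None \<Rightarrow> 0))"

definition form8 :: "complex \<Rightarrow> complex \<Rightarrow> complex \<Rightarrow> complex ^ gen \<Rightarrow> complex ^ gen \<Rightarrow> complex" where
  "form8 lam \<alpha> \<beta> x y = (\<Sum>a\<in>UNIV. \<Sum>b\<in>UNIV. x $ a * y $ b * form_value lam \<alpha> \<beta> a b)"

end

theory Submission
  imports Defs
begin

text \<open>
  Let $n$ be the four-dimensional filiform Lie algebra with products $[X_1,X_2]=X_3$ and
  $[X_1,X_3]=X_4$. The form $B$ identifies the odd part with the dual of the even part, and
  invariance says that the action of \<open>G 0\<close> on \<open>G 1\<close> is its coadjoint action. Hence the flag in
  \<open>G 1\<close> is the annihilator of the upper central series of \<open>G 0\<close>, and having dimensions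
  $4, 3, 2, 0$ it forces \<open>G 0\<close> to be $n$. This is carried out in coordinates: a basis of \<open>G 1\<close>
  adapted to the flag and its dual basis in \<open>G 0\<close> (\<open>dual_family\<close>, \<open>adapted_dual_bases_exist\<close>)
  are corrected to bases in which both the products of $n$ and the form are in standard shape
  (\<open>darboux_exists\<close>). All products of an even with an odd vector are then known.

  What remains is the product of two odd vectors. By invariance it is encoded in the trilinear form
  $T(u,v,w)=B([u,v],w)$ on \<open>G 1\<close>, which is totally symmetric and invariant under $n$. An invariant
  cubic form of the coadjoint representation is a combination of $y_4^3$ and
  $y_4(y_3^2-2y_2y_4)$, where $y_i$ is the $i$-th coordinate in the basis of \<open>G 1\<close> dual to
  $X_1,\dots,X_4$. So there are two parameters, and the algebra is isomorphic to \<open>bracket8 p q\<close>, whose only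
  free products are those generated by $[e_4,e_4]=qX_2+pX_4$ (\<open>bracket8_isomorphic\<close>). Taking
  $[e_4,e_4]$ itself as the new $X_2$ if $q\neq 0$, and $pX_2$ as the new $X_2$ if $q=0\neq p$,
  turns $(p,q)$ into $(0,1)$, $(1,0)$ or $(0,0)$ (\<open>shear_iso\<close>, \<open>bracket8_classification\<close>).

  The three algebras are told apart by the products of odd vectors: in the first one they
  vanish, in the second one they are central and not all zero, in the third one $[e_4,e_4]=X_2$ is
  not central. Finally $X_1,X_2,e_4$ generate every \<open>bracket8 p q\<close>
  under the action of the even part, so that invariance expresses a form by its values
  $B(X_1,v_2)$, $B(X_1,e_4)$ and $B(X_2,e_4)$ (\<open>bracket8_forms\<close>).
\<close>

section \<open>Coordinates on the model space\<close>

lemma sum_gen: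
  fixes f :: "gen \<Rightarrow> 'b::comm_monoid_add"
  shows "(\<Sum>a\<in>UNIV. f a) = f X1 + (f X2 + (f X3 + (f X4 + (f E4 + (f E3 + (f U2 + f V2))))))"
  by (simp add: UNIV_gen)

lemma all_gen: "(\<forall>a. P a) \<longleftrightarrow>
    P X1 \<and> P X2 \<and> P X3 \<and> P X4 \<and> P E4 \<and> P E3 \<and> P U2 \<and> P V2"
  by (metis gen.exhaust)

definition gen_vec ::
  "complex \<Rightarrow> complex \<Rightarrow> complex \<Rightarrow> complex \<Rightarrow> complex \<Rightarrow> complex \<Rightarrow> complex \<Rightarrow> complex \<Rightarrow> complex ^ gen"
  where "gen_vec a b c d e f g h = (\<chi> i. case i of X1 \<Rightarrow> a | X2 \<Rightarrow> b | X3 \<Rightarrow> c | X4 \<Rightarrow> d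
     | E4 \<Rightarrow> e | E3 \<Rightarrow> f | U2 \<Rightarrow> g | V2 \<Rightarrow> h)"

lemma gen_vec_nth [simp]:
  "gen_vec a b c d e f g h $ X1 = a" "gen_vec a b c d e f g h $ X2 = b"
  "gen_vec a b c d e f g h $ X3 = c" "gen_vec a b c d e f g h $ X4 = d"
  "gen_vec a b c d e f g h $ E4 = e" "gen_vec a b c d e f g h $ E3 = f"
  "gen_vec a b c d e f g h $ U2 = g" "gen_vec a b c d e f g h $ V2 = h"
  by (simp_all add: gen_vec_def)

lemma vec_eq_gen: "(x :: complex ^ gen) = y \<longleftrightarrow> x $ X1 = y $ X1 \<and> x $ X2 = y $ X2 \<and>
    x $ X3 = y $ X3 \<and> x $ X4 = y $ X4 \<and> x $ E4 = y $ E4 \<and> x $ E3 = y $ E3 \<and>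
    x $ U2 = y $ U2 \<and> x $ V2 = y $ V2"
  by (simp add: vec_eq_iff all_gen)

lemma axis_gen [simp]: "axis a (1::complex) $ (b::gen) = (if a = b then 1 else 0)"
  by (simp add: axis_def)

section \<open>The two-parameter family of brackets\<close>

text \<open>
  The bracket with $[e_4,e_4]=qX_2+pX_4$ in which even vectors act as in the three algebras of the
  theorem. The other terms with a factor \<open>q\<close> are those that the Jacobi identity and the
  invariance of the form require once $[e_4,e_4]$ has an $X_2$-component.
\<close>

definition bracket8 :: "complex \<Rightarrow> complex \<Rightarrow> complex ^ gen \<Rightarrow> complex ^ gen \<Rightarrow> complex ^ gen" where
  "bracket8 p q x y = gen_vec
     0
     (q * x $ E4 * y $ E4)
     (x $ X1 * y $ X2 - x $ X2 * y $ X1 + q / 2 * (x $ E3 * y $ E4 + x $ E4 * y $ E3))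
     (x $ X1 * y $ X3 - x $ X3 * y $ X1 + p * x $ E4 * y $ E4 - q / 2 * x $ E3 * y $ E3
       + q * (x $ U2 * y $ E4 + x $ E4 * y $ U2))
     0
     (x $ X1 * y $ E4 - x $ E4 * y $ X1)
     (x $ X1 * y $ E3 - x $ E3 * y $ X1)
     (x $ X2 * y $ E3 - x $ E3 * y $ X2 - x $ X3 * y $ E4 + x $ E4 * y $ X3)"

lemma g80_eq_bracket8: "g80 = bracket8 0 0"
  by (intro ext)
    (simp add: vec_eq_gen g80_def bracket8_def table_bracket_def table_product_def sum_gen
      koszul_def algebra_simps)

lemma g81_eq_bracket8: "g81 = bracket8 1 0"
  by (intro ext)
    (simp add: vec_eq_gen g81_def bracket8_def table_bracket_def table_product_def sum_gen
      koszul_def algebra_simps)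

lemma g82_eq_bracket8: "g82 = bracket8 0 1"
  by (intro ext)
    (simp add: vec_eq_gen g82_def bracket8_def table_bracket_def table_product_def sum_gen
      koszul_def algebra_simps)

section \<open>The family consists of odd-quadratic Lie superalgebras\<close>

lemma form8_gen: "form8 lam \<alpha> \<beta> x y =
    lam * (x $ X1 * y $ V2 + x $ V2 * y $ X1) - lam * (x $ X2 * y $ U2 + x $ U2 * y $ X2)
    + lam * (x $ X3 * y $ E3 + x $ E3 * y $ X3) - lam * (x $ X4 * y $ E4 + x $ E4 * y $ X4)
    + \<alpha> * (x $ X1 * y $ E4 + x $ E4 * y $ X1) + \<beta> * (x $ X2 * y $ E4 + x $ E4 * y $ X2)"
  by (simp add: form8_def form_value_def sum_gen algebra_simps)

lemma bit_cases: "(i::bit) = 0 \<or> i = 1"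
  by (cases i) auto

lemma even_iff: "x \<in> grading8 0 \<longleftrightarrow> x $ E4 = 0 \<and> x $ E3 = 0 \<and> x $ U2 = 0 \<and> x $ V2 = 0"
  by (auto simp: grading8_def all_gen)

lemma odd_iff: "x \<in> grading8 1 \<longleftrightarrow> x $ X1 = 0 \<and> x $ X2 = 0 \<and> x $ X3 = 0 \<and> x $ X4 = 0"
  by (auto simp: grading8_def all_gen)

lemma bv_graded: "bv a \<in> grading8 (parity a)"
  by (auto simp: grading8_def)

lemma linear_vecI:
  fixes f :: "complex ^ gen \<Rightarrow> complex ^ gen"
  assumes "\<And>x y. f (x + y) = f x + f y" "\<And>c x. f (c *s x) = c *s f x"
  shows "Vector_Spaces.linear (*s) (*s) f"
  using assms by unfold_locales (auto simp: vec.scale_right_distrib)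

lemma linear_vec_fieldI:
  fixes f :: "complex ^ gen \<Rightarrow> complex"
  assumes "\<And>x y. f (x + y) = f x + f y" "\<And>c x. f (c *s x) = c * f x"
  shows "Vector_Spaces.linear (*s) (*) f"
  using assms by unfold_locales (auto simp: vec.scale_right_distrib algebra_simps)

lemma linear_gen_eqI:
  assumes "Vector_Spaces.linear (*s) s (f :: complex ^ gen \<Rightarrow> 'b::ab_group_add)"
    and "Vector_Spaces.linear (*s) s g"
    and "\<And>a. f (bv a) = g (bv a)"
  shows "f x = g x"
proof -
  interpret f: Vector_Spaces.linear "(*s)" s f by fact
  interpret g: Vector_Spaces.linear "(*s)" s g by fact
  have "f (\<Sum>a\<in>UNIV. x $ a *s bv a) = g (\<Sum>a\<in>UNIV. x $ a *s bv a)"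
    by (simp add: f.sum g.sum f.scale g.scale assms(3))
  then show ?thesis by (simp add: basis_expansion)
qed

lemma bilinear_gen_eqI:
  assumes "\<And>y. Vector_Spaces.linear (*s) s (\<lambda>x. (f :: complex ^ gen \<Rightarrow> complex ^ gen \<Rightarrow> 'b::ab_group_add) x y)"
    and "\<And>x. Vector_Spaces.linear (*s) s (f x)"
    and "\<And>y. Vector_Spaces.linear (*s) s (\<lambda>x. g x y)"
    and "\<And>x. Vector_Spaces.linear (*s) s (g x)"
    and "\<And>a b. f (bv a) (bv b) = g (bv a) (bv b)"
  shows "f x y = g x y"
proof -
  have "f (bv a) y = g (bv a) y" for a
    by (rule linear_gen_eqI[OF assms(2,4,5)])
  then show ?thesis
    by (rule linear_gen_eqI[OF assms(1,3)])
qed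

lemma bracket8_superalgebra: "lie_superalgebra (*s) grading8 (bracket8 p q)"
proof (intro lie_superalgebra.intro lie_superalgebra_axioms.intro vec.vector_space_axioms)
  fix i
  show "vec.subspace (grading8 i)"
    using bit_cases[of i] by (auto simp: vec.subspace_def even_iff odd_iff)
  show "grading8 0 \<inter> grading8 1 = {0}"
    by (auto simp: even_iff odd_iff vec_eq_gen)
  show "\<exists>y\<in>grading8 0. \<exists>z\<in>grading8 1. x = y + z" for x
    by (rule bexI[of _ "gen_vec (x $ X1) (x $ X2) (x $ X3) (x $ X4) 0 0 0 0"],
        rule bexI[of _ "gen_vec 0 0 0 0 (x $ E4) (x $ E3) (x $ U2) (x $ V2)"])
      (auto simp: even_iff odd_iff vec_eq_gen)
  show "Vector_Spaces.linear (*s) (*s) (\<lambda>x. bracket8 p q x y)" for y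
    by (rule linear_vecI) (simp_all add: vec_eq_gen bracket8_def algebra_simps)
  show "Vector_Spaces.linear (*s) (*s) (bracket8 p q x)" for x
    by (rule linear_vecI) (simp_all add: vec_eq_gen bracket8_def algebra_simps)
  show "bracket8 p q x y \<in> grading8 (i + j)" if "x \<in> grading8 i" "y \<in> grading8 j" for i j x y
    using that bit_cases[of i] bit_cases[of j]
    by (elim disjE) (simp_all add: even_iff odd_iff bracket8_def)
  show "bracket8 p q x y = (- koszul i j) *s bracket8 p q y x"
    if "x \<in> grading8 i" "y \<in> grading8 j" for i j x y
    using that bit_cases[of i] bit_cases[of j]
    by (elim disjE)
      (simp_all add: even_iff odd_iff bracket8_def vec_eq_gen koszul_def algebra_simps)
  show "bracket8 p q x (bracket8 p q y z) =
      bracket8 p q (bracket8 p q x y) z + koszul i j *s bracket8 p q y (bracket8 p q x z)"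
    if "x \<in> grading8 i" "y \<in> grading8 j" "z \<in> grading8 k" for i j k x y z
    using that bit_cases[of i] bit_cases[of j] bit_cases[of k]
    by (elim disjE)
      (simp_all add: even_iff odd_iff bracket8_def vec_eq_gen koszul_def field_simps)
qed

lemma form8_linear:
  "Vector_Spaces.linear (*s) (*) (\<lambda>x. form8 lam \<alpha> \<beta> x y)"
  "Vector_Spaces.linear (*s) (*) (form8 lam \<alpha> \<beta> x)"
  by (rule linear_vec_fieldI; simp add: form8_gen algebra_simps)+

lemma bracket8_odd_quadratic:
  assumes "lam \<noteq> 0"
  shows "odd_quadratic_lie_superalgebra (*s) grading8 (bracket8 p q) (form8 lam \<alpha> \<beta>)"
proof -
  interpret lie_superalgebra "(*s)" grading8 "bracket8 p q"
    by (rule bracket8_superalgebra)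
  show ?thesis
  proof (intro odd_quadratic_lie_superalgebra.intro odd_quadratic_lie_superalgebra_axioms.intro
      lie_superalgebra_axioms)
    show "Vector_Spaces.linear (*s) (*) (\<lambda>x. form8 lam \<alpha> \<beta> x y)" for y
      by (rule form8_linear)
    show "Vector_Spaces.linear (*s) (*) (form8 lam \<alpha> \<beta> x)" for x
      by (rule form8_linear)
    show "form8 lam \<alpha> \<beta> x y = koszul i j * form8 lam \<alpha> \<beta> y x"
      if "x \<in> grading8 i" "y \<in> grading8 j" for i j x y
      using that bit_cases[of i] bit_cases[of j]
      by (elim disjE) (simp_all add: even_iff odd_iff form8_gen koszul_def algebra_simps)
    show "form8 lam \<alpha> \<beta> (bracket8 p q x y) z = form8 lam \<alpha> \<beta> x (bracket8 p q y z)" for x y z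
      by (simp add: form8_gen bracket8_def field_simps)
    show "form8 lam \<alpha> \<beta> x y = 0" if "x \<in> grading8 i" "y \<in> grading8 i" for i x y
      using that bit_cases[of i] by (elim disjE) (simp_all add: even_iff odd_iff form8_gen)
    show "x = 0" if *: "\<And>y. form8 lam \<alpha> \<beta> x y = 0" for x
      using *[of "bv X1"] *[of "bv X2"] *[of "bv X3"] *[of "bv X4"]
        *[of "bv E4"] *[of "bv E3"] *[of "bv U2"] *[of "bv V2"] assms
      by (simp add: form8_gen vec_eq_gen)
  qed
qed

text \<open>
  The isomorphism rescales $X_2,X_3,X_4,v_2$ by $r$ and adds $sX_4$ to the image of $X_2$. As $X_4$
  is central and the odd vectors $e_4,e_3,u_2$ stay fixed, only the coordinates of $[e_4,e_4]$ (and
  the products generated by it) are affected: $QX_2+PX_4$ is sent to $Q(rX_2+sX_4)+PrX_4$. In this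
  way both parameters are normalised without extracting roots.
\<close>

lemma shear_iso:
  assumes "r \<noteq> 0"
  shows "lie_superalgebra_isomorphic (*s) grading8 (bracket8 P Q)
    (*s) grading8 (bracket8 (Q * s + P * r) (Q * r))"
proof -
  define f where "f x = gen_vec (x $ X1) (r * x $ X2) (r * x $ X3) (s * x $ X2 + r * x $ X4)
    (x $ E4) (x $ E3) (x $ U2) (r * x $ V2)" for x
  define g where "g x = gen_vec (x $ X1) (x $ X2 / r) (x $ X3 / r) ((x $ X4 - s * x $ X2 / r) / r)
    (x $ E4) (x $ E3) (x $ U2) (x $ V2 / r)" for x
  have fg: "f (g x) = x" and gf: "g (f x) = x" for x
    using assms by (simp_all add: f_def g_def vec_eq_gen)
  have "bij f"
    by (rule bij_betw_byWitness[of _ g]) (auto simp: fg gf)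
  moreover have "f ` grading8 i = grading8 i" for i
  proof
    show "f ` grading8 i \<subseteq> grading8 i"
      using bit_cases[of i] by (auto simp: even_iff odd_iff f_def)
    have "g ` grading8 i \<subseteq> grading8 i"
      using bit_cases[of i] by (auto simp: even_iff odd_iff g_def)
    then show "grading8 i \<subseteq> f ` grading8 i"
      by (metis fg image_eqI image_subset_iff subsetI)
  qed
  moreover have "Vector_Spaces.linear (*s) (*s) f"
    by (rule linear_vecI) (simp_all add: f_def vec_eq_gen algebra_simps)
  moreover have "f (bracket8 P Q x y) = bracket8 (Q * s + P * r) (Q * r) (f x) (f y)" for x y
    by (simp add: f_def bracket8_def vec_eq_gen algebra_simps)
  ultimately show ?thesis
    by (auto simp: lie_superalgebra_isomorphic_def lie_superalgebra_iso_def)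
qed

section \<open>Bracket and form in an odd-quadratic Lie superalgebra\<close>

context lie_superalgebra
begin

lemma brk_add_left: "brk (x + y) z = brk x z + brk y z"
  and brk_scale_left: "brk (scl c x) z = scl c (brk x z)"
  and brk_add_right: "brk z (x + y) = brk z x + brk z y"
  and brk_scale_right: "brk z (scl c x) = scl c (brk z x)"
  using brk_linear_left[of z] brk_linear_right[of z]
  by (auto simp: Vector_Spaces.linear_iff)

lemma brk_zero_right [simp]: "brk z 0 = 0"
  using brk_scale_right[of z 0 0] by simp

lemma brk_minus_right: "brk z (- x) = - brk z x"
  using brk_scale_right[of z "-1" x] by simp

lemma brk_minus_left: "brk (- x) z = - brk x z"
  using brk_scale_left[of "-1" x z] by simp

lemma brk_diff_left: "brk (x - y) z = brk x z - brk y z"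
  using brk_add_left[of x "-y" z] by (simp add: brk_minus_left)

lemma brk_diff_right: "brk z (x - y) = brk z x - brk z y"
  using brk_add_right[of z x "-y"] by (simp add: brk_minus_right)

lemma brk_even_skew: "x \<in> G 0 \<Longrightarrow> y \<in> G i \<Longrightarrow> brk y x = - brk x y"
  using brk_superskew[of x 0 y i] by (simp add: koszul_def)

lemma brk_even_self: assumes "x \<in> G 0" shows "brk x x = 0"
proof -
  have "scl 2 (brk x x) = brk x x + brk x x"
    using scale_left_distrib[of 1 1 "brk x x"] by simp
  also have "\<dots> = 0" using brk_even_skew[OF assms assms] by (simp add: eq_neg_iff_add_eq_0)
  finally show ?thesis by simp
qed

lemma brk_odd_sym: "x \<in> G 1 \<Longrightarrow> y \<in> G 1 \<Longrightarrow> brk x y = brk y x"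
  using brk_superskew[of x 1 y 1] by (simp add: koszul_def)

end

context odd_quadratic_lie_superalgebra
begin

lemma form_add_left: "B (x + y) z = B x z + B y z"
  and form_scale_left: "B (scl c x) z = c * B x z"
  and form_add_right: "B z (x + y) = B z x + B z y"
  and form_scale_right: "B z (scl c x) = c * B z x"
  using form_linear_left[of z] form_linear_right[of z]
  by (auto simp: Vector_Spaces.linear_iff)

lemma form_zero_left [simp]: "B 0 x = 0"
  using form_scale_left[of 0 0 x] by simp

lemma form_zero_right [simp]: "B x 0 = 0"
  using form_scale_right[of x 0 0] by simp

lemma form_minus_left: "B (- x) z = - B x z"
  using form_scale_left[of "-1" x z] by simp

lemma form_minus_right: "B z (- x) = - B z x"
  using form_scale_right[of z "-1" x] by simp

lemma form_diff_left: "B (x - y) z = B x z - B y z"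
  using form_add_left[of x "-y" z] by (simp add: form_minus_left)

lemma form_diff_right: "B z (x - y) = B z x - B z y"
  using form_add_right[of z x "-y"] by (simp add: form_minus_right)

lemma form_sum_left: "B (\<Sum>i\<in>I. h i) z = (\<Sum>i\<in>I. B (h i) z)"
  by (induction I rule: infinite_finite_induct) (simp_all add: form_add_left)

lemma form_sum_right: "B z (\<Sum>i\<in>I. h i) = (\<Sum>i\<in>I. B z (h i))"
  by (induction I rule: infinite_finite_induct) (simp_all add: form_add_right)

lemmas form_linear_simps = form_add_left form_add_right form_scale_left form_scale_right
  form_diff_left form_diff_right form_minus_left form_minus_right

text \<open>
  The sign in supersymmetry is $-1$ only on two odd vectors, where an odd form vanishes.
\<close>

lemma form_commute: "B x y = B y x"
proof -
  obtain x0 x1 y0 y1 where d: "x0 \<in> G 0" "x1 \<in> G 1" "y0 \<in> G 0" "y1 \<in> G 1"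
    "x = x0 + x1" "y = y0 + y1"
    using G_spanning[of x] G_spanning[of y] by auto
  have "B x0 y1 = B y1 x0" "B x1 y0 = B y0 x1"
    using d form_supersymmetric[of x0 0 y1 1] form_supersymmetric[of x1 1 y0 0]
    by (simp_all add: koszul_def)
  moreover have "B x0 y0 = 0" "B y0 x0 = 0" "B x1 y1 = 0" "B y1 x1 = 0"
    using d form_odd by blast+
  ultimately show ?thesis
    by (simp add: d form_linear_simps)
qed

text \<open>
  Since \<open>B\<close> is odd, its nondegeneracy means that it pairs \<open>G 0\<close> and \<open>G 1\<close> nondegenerately.
\<close>

lemma even_zeroI: assumes "x \<in> G 0" "\<And>y. y \<in> G 1 \<Longrightarrow> B x y = 0" shows "x = 0"
proof (rule form_nondegenerate)
  fix y
  obtain y0 y1 where "y0 \<in> G 0" "y1 \<in> G 1" "y = y0 + y1" using G_spanning[of y] by auto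
  then show "B x y = 0"
    using assms form_odd[of x 0 y0] by (simp add: form_linear_simps)
qed

lemma odd_zeroI: assumes "y \<in> G 1" "\<And>x. x \<in> G 0 \<Longrightarrow> B x y = 0" shows "y = 0"
proof (rule form_nondegenerate)
  fix x
  obtain x0 x1 where "x0 \<in> G 0" "x1 \<in> G 1" "x = x0 + x1" using G_spanning[of x] by auto
  then have "B x y = 0"
    using assms form_odd[of x1 1 y] by (simp add: form_linear_simps)
  then show "B y x = 0" by (simp add: form_commute)
qed

lemma form_subspace: "subspace {y. B x y = 0}"
  by (rule subspaceI) (auto simp: form_linear_simps)

lemma form_zero_on_span: "(\<And>y. y \<in> S \<Longrightarrow> B x y = 0) \<Longrightarrow> y \<in> span S \<Longrightarrow> B x y = 0"
  using span_minimal[OF _ form_subspace, of S x] by blast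

lemma independentI_form:
  assumes "\<And>a. a \<in> A \<Longrightarrow> \<exists>x. B x a \<noteq> 0 \<and> (\<forall>a'\<in>A - {a}. B x a' = 0)"
  shows "independent A"
proof
  assume "dependent A"
  then obtain a where "a \<in> A" "a \<in> span (A - {a})" by (auto simp: dependent_def)
  then show False using assms[of a] form_zero_on_span[of "A - {a}"] by blast
qed

text \<open>
  Subtracting the components along a dual family projects \<open>x\<close> onto the annihilator of \<open>F\<close>.
\<close>

lemma form_residual:
  assumes "finite F" "f \<in> F"
    and "\<And>f'. f' \<in> F \<Longrightarrow> B (d f') f = (if f' = f then 1 else 0)"
  shows "B (x - (\<Sum>f\<in>F. scl (B x f) (d f))) f = 0"
proof -
  have "(\<Sum>f'\<in>F. B x f' * B (d f') f) = (\<Sum>f'\<in>F. if f' = f then B x f' else 0)"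
    by (rule sum.cong) (simp_all add: assms(3))
  then show ?thesis
    using assms(1,2) by (simp add: form_linear_simps form_sum_left)
qed

text \<open>
  A nondegenerate pairing realises every coordinate functional of a finite independent set of odd
  vectors by an even vector. To extend a dual family of \<open>F\<close> to \<open>insert g F\<close> one needs an even
  vector in the annihilator of \<open>F\<close> that does not kill \<open>g\<close>; if there were none, the projection
  above would show that \<open>g\<close> and \<open>\<Sum>f\<in>F. scl (B (d f) g) f\<close> pair equally with all of \<open>G 0\<close>,
  and \<open>g\<close> would lie in the span of \<open>F\<close>.
\<close>

lemma dual_family:
  assumes "finite F" "independent F" "F \<subseteq> G 1"
  shows "\<exists>d. \<forall>f\<in>F. d f \<in> G 0 \<and> (\<forall>f'\<in>F. B (d f) f' = (if f' = f then 1 else 0))"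
  using assms
proof (induction F)
  case (insert g F)
  have ind: "independent F" and gF: "g \<notin> span F"
    using insert.prems insert.hyps by (auto simp: independent_insert)
  with insert obtain d where
    d: "\<And>f. f \<in> F \<Longrightarrow> d f \<in> G 0" "\<And>f f'. f \<in> F \<Longrightarrow> f' \<in> F \<Longrightarrow> B (d f) f' = (if f' = f then 1 else 0)"
    by auto
  define r where "r x = x - (\<Sum>f\<in>F. scl (B x f) (d f))" for x
  have r_even: "r x \<in> G 0" if "x \<in> G 0" for x
    unfolding r_def using that d(1)
    by (auto intro!: subspace_diff subspace_sum subspace_scale subspace_G)
  have r_kills: "B (r x) f = 0" if "f \<in> F" for x f
    unfolding r_def using insert.hyps(1) that by (rule form_residual) (simp add: d(2) that)
  have "\<exists>x\<in>G 0. B (r x) g \<noteq> 0"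
  proof (rule ccontr)
    assume "\<not> ?thesis"
    then have z: "B (r x) g = 0" if "x \<in> G 0" for x using that by blast
    define h where "h = g - (\<Sum>f\<in>F. scl (B (d f) g) f)"
    have "h \<in> G 1"
      unfolding h_def using insert.prems
      by (auto intro!: subspace_diff subspace_sum subspace_scale subspace_G)
    moreover have "B x h = 0" if "x \<in> G 0" for x
      using z[OF that]
      by (simp add: r_def h_def form_linear_simps form_sum_left form_sum_right mult.commute)
    ultimately have "h = 0" by (rule odd_zeroI)
    then have "g = (\<Sum>f\<in>F. scl (B (d f) g) f)" by (simp add: h_def)
    also have "\<dots> \<in> span F" by (intro span_sum span_scale span_base)
    finally show False using gF by simp
  qed
  then obtain x where x: "x \<in> G 0" "B (r x) g \<noteq> 0" by blast
  define y where "y = scl (1 / B (r x) g) (r x)"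
  have y: "y \<in> G 0" "B y g = 1" "\<And>f. f \<in> F \<Longrightarrow> B y f = 0"
    using x r_even r_kills by (auto simp: y_def form_linear_simps intro: subspace_scale subspace_G)
  have "g \<notin> F" by fact
  let ?d = "\<lambda>f. if f = g then y else d f - scl (B (d f) g) y"
  have "\<forall>f\<in>insert g F. ?d f \<in> G 0 \<and> (\<forall>f'\<in>insert g F. B (?d f) f' = (if f' = f then 1 else 0))"
    using y d \<open>g \<notin> F\<close>
    by (auto simp: form_linear_simps intro!: subspace_diff subspace_scale subspace_G)
  then show ?case by (rule exI[of _ ?d])
qed simp

text \<open>
  The dual family of a basis of \<open>G 1\<close> is a basis of \<open>G 0\<close>.
\<close>

lemma dim_even_eq_dim_odd:
  assumes "dim (G 1) > 0"
  shows "dim (G 0) = dim (G 1)"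
proof -
  obtain F where F: "F \<subseteq> G 1" "independent F" "G 1 \<subseteq> span F" "card F = dim (G 1)"
    using basis_exists by blast
  have fin: "finite F" using assms F(4) card_ge_0_finite[of F] by simp
  obtain d where
    d: "\<And>f. f \<in> F \<Longrightarrow> d f \<in> G 0" "\<And>f f'. f \<in> F \<Longrightarrow> f' \<in> F \<Longrightarrow> B (d f) f' = (if f' = f then 1 else 0)"
    using dual_family[OF fin F(2,1)] by blast
  have inj: "inj_on d F"
  proof (rule inj_onI)
    fix f g assume "f \<in> F" "g \<in> F" "d f = d g"
    then have "(if f = g then 1 else 0 :: complex) = 1"
      using d(2)[of f f] d(2)[of g f] by simp
    then show "f = g" by (simp split: if_splits)
  qed
  have "independent (d ` F)"
  proof (rule independentI_form)
    fix a assume "a \<in> d ` F"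
    then obtain f where f: "f \<in> F" "a = d f" by blast
    then have "B f a \<noteq> 0"
      using d(2)[of f f] by (simp add: form_commute[of f])
    moreover have "B f (d g) = 0" if "g \<in> F" "d g \<noteq> a" for g
      using that f d(2)[of g f] by (auto simp: form_commute[of f])
    ultimately have "B f a \<noteq> 0 \<and> (\<forall>a'\<in>d ` F - {a}. B f a' = 0)" by blast
    then show "\<exists>x. B x a \<noteq> 0 \<and> (\<forall>a'\<in>d ` F - {a}. B x a' = 0)" by blast
  qed
  moreover have "G 0 \<subseteq> span (d ` F)"
  proof
    fix x assume x: "x \<in> G 0"
    define r where "r = x - (\<Sum>f\<in>F. scl (B x f) (d f))"
    have "r \<in> G 0"
      unfolding r_def using x d(1)
      by (auto intro!: subspace_diff subspace_sum subspace_scale subspace_G)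
    moreover have "B r f = 0" if "f \<in> F" for f
      unfolding r_def using fin that by (rule form_residual) (simp add: d(2) that)
    then have "B r y = 0" if "y \<in> G 1" for y
      using that form_zero_on_span[of F r y] F(3) by blast
    ultimately have "r = 0" by (rule even_zeroI)
    then have "x = (\<Sum>f\<in>F. scl (B x f) (d f))" by (simp add: r_def)
    also have "\<dots> \<in> span (d ` F)" by (intro span_sum span_scale span_base) auto
    finally show "x \<in> span (d ` F)" .
  qed
  moreover have "d ` F \<subseteq> G 0" using d(1) by blast
  ultimately have "dim (G 0) = card (d ` F)" using dim_unique[of "d ` F" "G 0"] by simp
  then show ?thesis using F(4) card_image[OF inj] by simp
qed

end

lemma (in vector_space) finite_dimensional_if_dim_pos:
  assumes "dim UNIV > 0"
  shows "\<exists>Bs. finite_dimensional_vector_space scale Bs"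
proof -
  obtain Bs where Bs: "independent Bs" "UNIV \<subseteq> span Bs" "card Bs = dim UNIV"
    using basis_exists[of UNIV] by metis
  have "finite Bs" using assms Bs(3) card_ge_0_finite[of Bs] by simp
  then have "finite_dimensional_vector_space scale Bs"
    using Bs(1,2) vector_space_axioms
    by (intro finite_dimensional_vector_space.intro finite_dimensional_vector_space_axioms.intro
        top.extremum_uniqueI)
  then show ?thesis ..
qed

lemma (in odd_quadratic_lie_superalgebra) dim_odd_if_dim_8:
  assumes "dim (G 1) > 0" "dim UNIV = 8"
  shows "dim (G 1) = 4"
proof -
  obtain Bs where "finite_dimensional_vector_space scl Bs"
    using finite_dimensional_if_dim_pos unfolding assms(2) by auto
  then interpret fd: finite_dimensional_vector_space scl Bs .
  have "{x + y |x y. x \<in> G 0 \<and> y \<in> G 1} = UNIV"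
    using G_spanning by blast
  then have "dim {x + y |x y. x \<in> G 0 \<and> y \<in> G 1} = 8"
    using assms(2) by (simp only:)
  moreover have "dim {x + y |x y. x \<in> G 0 \<and> y \<in> G 1} + dim (G 0 \<inter> G 1) = dim (G 0) + dim (G 1)"
    by (rule fd.dim_sums_Int) (rule subspace_G)+
  moreover have "dim (G 0 \<inter> G 1) = 0" unfolding G_disjoint by (rule fd.dim_eq_0[THEN iffD2]) simp
  ultimately show ?thesis using dim_even_eq_dim_odd[OF assms(1)] by linarith
qed

section \<open>Algebras with a basis adapted to bracket and form\<close>

text \<open>
  The basis vectors satisfy the even products of the three algebras and pair as in the form with
  $\lambda=1$ and $\alpha=\beta=0$. Under these assumptions the whole bracket is determined up to
  the two numbers \<open>p\<close> and \<open>q\<close> below.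
\<close>

locale darboux_filiform = odd_quadratic_lie_superalgebra scl G brk B
  for scl :: "complex \<Rightarrow> 'a::ab_group_add \<Rightarrow> 'a" and G brk B +
  fixes b :: "gen \<Rightarrow> 'a"
  assumes b_graded: "b a \<in> G (parity a)"
    and b_form: "B (b a) (b c) = form_value 1 0 0 a c"
    and odd_span: "G 1 \<subseteq> span {b E4, b E3, b U2, b V2}"
    and b_rel: "brk (b X1) (b X2) = b X3" "brk (b X1) (b X3) = b X4" "brk (b X2) (b X3) = 0"
      "brk (b X1) (b X4) = 0" "brk (b X2) (b X4) = 0" "brk (b X3) (b X4) = 0"
begin

lemma b_even: "b X1 \<in> G 0" "b X2 \<in> G 0" "b X3 \<in> G 0" "b X4 \<in> G 0"
  and b_odd: "b E4 \<in> G 1" "b E3 \<in> G 1" "b U2 \<in> G 1" "b V2 \<in> G 1"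
  using b_graded[of X1] b_graded[of X2] b_graded[of X3] b_graded[of X4]
    b_graded[of E4] b_graded[of E3] b_graded[of U2] b_graded[of V2] by simp_all

lemmas form_table = form_value_def b_form Let_def

lemma even_expansion:
  assumes "x \<in> G 0"
  shows "x = scl (B x (b V2)) (b X1) - scl (B x (b U2)) (b X2) + scl (B x (b E3)) (b X3)
    - scl (B x (b E4)) (b X4)" (is "x = ?r")
proof -
  have "x - ?r = 0"
  proof (rule even_zeroI)
    show "x - ?r \<in> G 0"
      by (intro subspace_diff subspace_add subspace_scale subspace_G b_even assms)
    show "B (x - ?r) y = 0" if "y \<in> G 1" for y
    proof (rule form_zero_on_span)
      show "y \<in> span {b E4, b E3, b U2, b V2}" using odd_span that by blast
    qed (auto simp: form_linear_simps form_table)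
  qed
  then show ?thesis by simp
qed

lemma odd_eqI:
  assumes "y \<in> G 1" "z \<in> G 1"
    and "B (b X1) y = B (b X1) z" "B (b X2) y = B (b X2) z"
    and "B (b X3) y = B (b X3) z" "B (b X4) y = B (b X4) z"
  shows "y = z"
proof -
  have "y - z = 0"
  proof (rule odd_zeroI)
    show "y - z \<in> G 1" using assms subspace_diff subspace_G by blast
    show "B x (y - z) = 0" if "x \<in> G 0" for x
      by (subst even_expansion[OF that]) (simp add: form_linear_simps assms(3-))
  qed
  then show ?thesis by simp
qed

lemma odd_expansion:
  assumes "y \<in> G 1"
  shows "y = scl (B (b X1) y) (b V2) - scl (B (b X2) y) (b U2) + scl (B (b X3) y) (b E3)
    - scl (B (b X4) y) (b E4)"
  by (rule odd_eqI)
    (auto simp: form_linear_simps form_table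
      intro!: subspace_diff subspace_add subspace_scale subspace_G b_odd assms)

lemma brk_even_even:
  "brk (b X1) (b X1) = 0" "brk (b X2) (b X2) = 0" "brk (b X3) (b X3) = 0" "brk (b X4) (b X4) = 0"
  "brk (b X2) (b X1) = - b X3" "brk (b X3) (b X1) = - b X4" "brk (b X3) (b X2) = 0"
  "brk (b X4) (b X1) = 0" "brk (b X4) (b X2) = 0" "brk (b X4) (b X3) = 0"
  using b_even brk_even_self brk_even_skew[of "b X1" "b X2" 0] brk_even_skew[of "b X1" "b X3" 0]
    brk_even_skew[of "b X2" "b X3" 0] brk_even_skew[of "b X1" "b X4" 0]
    brk_even_skew[of "b X2" "b X4" 0] brk_even_skew[of "b X3" "b X4" 0]
  by (simp_all add: b_rel)

lemma brk_even_odd_closed: "x \<in> G 0 \<Longrightarrow> y \<in> G 1 \<Longrightarrow> brk x y \<in> G 1"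
  using brk_graded[of x 0 y 1] by simp

lemma zero_in_G: "0 \<in> G i"
  using subspace_0[OF subspace_G] .

text \<open>
  The coadjoint action: by invariance, $B(X_j,[X_i,f])=B([X_j,X_i],f)$ involves even products only.
\<close>

lemma brk_even_odd:
  "brk (b X1) (b E4) = b E3" "brk (b X1) (b E3) = b U2" "brk (b X1) (b U2) = 0" "brk (b X1) (b V2) = 0"
  "brk (b X2) (b E4) = 0" "brk (b X2) (b E3) = b V2" "brk (b X2) (b U2) = 0" "brk (b X2) (b V2) = 0"
  "brk (b X3) (b E4) = - b V2" "brk (b X3) (b E3) = 0" "brk (b X3) (b U2) = 0" "brk (b X3) (b V2) = 0"
  "brk (b X4) (b E4) = 0" "brk (b X4) (b E3) = 0" "brk (b X4) (b U2) = 0" "brk (b X4) (b V2) = 0"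
  by (rule odd_eqI;
      simp add: form_invariant[symmetric] brk_even_even b_rel form_linear_simps form_table
        brk_even_odd_closed b_even b_odd zero_in_G subspace_neg[OF subspace_G])+

lemma brk_odd_even:
  assumes "i \<in> {X1, X2, X3, X4}" "j \<in> {E4, E3, U2, V2}"
  shows "brk (b j) (b i) = - brk (b i) (b j)"
  using assms b_even b_odd by (auto intro: brk_even_skew)

abbreviation T :: "gen \<Rightarrow> gen \<Rightarrow> gen \<Rightarrow> complex" where
  "T j k l \<equiv> B (brk (b j) (b k)) (b l)"

lemma cubic_rotate: "B (brk x y) z = B (brk y z) x"
  by (simp add: form_invariant form_commute[of x])

text \<open>
  The trilinear form $B([u,v],w)$ on odd vectors is annihilated by the even part. This is where the
  Jacobi identity for one even and two odd vectors enters.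
\<close>

lemma cubic_invariant:
  assumes "x \<in> G 0" "u \<in> G 1" "v \<in> G 1"
  shows "B (brk (brk x u) v) w + B (brk u (brk x v)) w + B (brk u v) (brk x w) = 0"
proof -
  have "brk u v \<in> G 0" using brk_graded[of u 1 v 1] assms by simp
  then have "B (brk u v) (brk x w) = - B (brk x (brk u v)) w"
    using brk_even_skew[of x "brk u v" 0] assms(1)
    by (simp add: form_invariant[symmetric] form_linear_simps)
  then show ?thesis
    using super_jacobi[of x 0 u 1 v 1] assms by (simp add: koszul_def form_linear_simps)
qed

text \<open>
  Both rules permute indices. As rewrite rules they bring \<open>T\<close> into the form with indices in the
  order \<open>E3, E4, U2, V2\<close>, and all values of \<open>T\<close> are stated in that form.
\<close>

lemma cubic_perm:
  assumes "parity j = 1" "parity k = 1" "parity l = 1"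
  shows "T j k l = T k j l" "T j k l = T j l k"
proof -
  have odd: "b j \<in> G 1" "b k \<in> G 1" "b l \<in> G 1"
    using b_graded assms by metis+
  show "T j k l = T k j l" using odd by (simp add: brk_odd_sym)
  have "T j k l = T l j k" using cubic_rotate[of "b l" "b j" "b k"] by simp
  then show "T j k l = T j l k" using odd brk_odd_sym[of "b l" "b j"] by simp
qed

text \<open>
  As $X_2$ sends $e_3$ to $v_2$ and kills the other odd basis vectors, invariance under $X_2$ on
  triples that contain $e_3$ gives a nonzero multiple of $T(v_2,\cdot,\cdot)$.
\<close>

lemma cubic_V2: "T E4 E4 V2 = 0" "T E3 E4 V2 = 0" "T E4 U2 V2 = 0" "T E4 V2 V2 = 0"
  "T E3 E3 V2 = 0" "T E3 U2 V2 = 0" "T E3 V2 V2 = 0" "T U2 U2 V2 = 0" "T U2 V2 V2 = 0" "T V2 V2 V2 = 0"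
proof -
  note I = cubic_invariant[OF b_even(2) b_odd(2)]
  show "T E4 E4 V2 = 0" "T E3 E4 V2 = 0" "T E4 U2 V2 = 0" "T E4 V2 V2 = 0"
    "T E3 E3 V2 = 0" "T E3 U2 V2 = 0" "T E3 V2 V2 = 0" "T U2 U2 V2 = 0" "T U2 V2 V2 = 0" "T V2 V2 V2 = 0"
    using I[of "b E4" "b E4"] I[of "b E4" "b E3"] I[of "b E4" "b U2"] I[of "b E4" "b V2"]
      I[of "b E3" "b E3"] I[of "b E3" "b U2"] I[of "b E3" "b V2"]
      I[of "b U2" "b U2"] I[of "b U2" "b V2"] I[of "b V2" "b V2"]
    by (simp_all add: b_odd brk_even_odd cubic_perm)
qed

text \<open>
  Here $X_1$ acts as the nilpotent chain $e_4\mapsto e_3\mapsto u_2\mapsto 0$, so that, on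
  $e_4,e_3,u_2$, invariance under $X_1$ leaves only $T(e_4,e_4,e_4)$ and $T(e_4,e_4,u_2)$ undetermined.
\<close>

lemma cubic_values:
  "T E3 E4 E4 = 0" "T E3 E3 E4 = - T E4 E4 U2 / 2" "T E3 E4 U2 = 0" "T E4 U2 U2 = 0"
  "T E3 E3 E3 = 0" "T E3 E3 U2 = 0" "T E3 U2 U2 = 0" "T U2 U2 U2 = 0"
proof -
  note I = cubic_invariant[OF b_even(1)]
  have 1: "T E3 E4 E4 = 0"
    using I[of "b E4" "b E4" "b E4"] by (simp add: b_odd brk_even_odd cubic_perm)
  have 2: "2 * T E3 E3 E4 + T E4 E4 U2 = 0"
    using I[of "b E4" "b E4" "b E3"] by (simp add: b_odd brk_even_odd cubic_perm)
  have 3: "T E3 E4 U2 = 0"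
    using I[of "b E4" "b E4" "b U2"] by (simp add: b_odd brk_even_odd cubic_perm)
  have 4: "T E3 E3 E3 = 0"
    using I[of "b E3" "b E3" "b E4"] 3 by (simp add: b_odd brk_even_odd cubic_perm)
  have 5: "T E3 E3 U2 = 0"
    using I[of "b E3" "b E3" "b E3"] by (simp add: b_odd brk_even_odd cubic_perm)
  have 6: "T E4 U2 U2 = 0"
    using I[of "b E4" "b E3" "b U2"] 5 by (simp add: b_odd brk_even_odd cubic_perm)
  have 7: "T E3 U2 U2 = 0"
    using I[of "b E4" "b U2" "b U2"] by (simp add: b_odd brk_even_odd cubic_perm)
  have 8: "T U2 U2 U2 = 0"
    using I[of "b E3" "b U2" "b U2"] by (simp add: b_odd brk_even_odd cubic_perm)
  show "T E3 E4 E4 = 0" "T E3 E3 E4 = - T E4 E4 U2 / 2" "T E3 E4 U2 = 0" "T E4 U2 U2 = 0"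
    "T E3 E3 E3 = 0" "T E3 E3 U2 = 0" "T E3 U2 U2 = 0" "T U2 U2 U2 = 0"
    using 1 3 4 5 6 7 8 2 by (simp_all add: field_simps eq_neg_iff_add_eq_0)
qed

text \<open>
  The coordinates of $[e_4,e_4]$ along $X_4$ and $X_2$, with the signs coming from
  $B(X_4,e_4)=B(X_2,u_2)=-1$.
\<close>

definition "p = - T E4 E4 E4"
definition "q = - T E4 E4 U2"

lemma brk_odd_odd:
  "brk (b E4) (b E4) = scl q (b X2) + scl p (b X4)"
  "brk (b E4) (b E3) = scl (q / 2) (b X3)" "brk (b E4) (b U2) = scl q (b X4)"
  "brk (b E3) (b E3) = - scl (q / 2) (b X4)" "brk (b E3) (b U2) = 0" "brk (b U2) (b U2) = 0"
  "brk (b V2) (b E4) = 0" "brk (b V2) (b E3) = 0" "brk (b V2) (b U2) = 0" "brk (b V2) (b V2) = 0"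
proof -
  have even: "brk x y \<in> G 0" if "x \<in> G 1" "y \<in> G 1" for x y
    using brk_graded[of x 1 y 1] that by simp
  note ex = even_expansion[OF even]
  show "brk (b E4) (b E4) = scl q (b X2) + scl p (b X4)"
    "brk (b E4) (b E3) = scl (q / 2) (b X3)" "brk (b E4) (b U2) = scl q (b X4)"
    "brk (b E3) (b E3) = - scl (q / 2) (b X4)" "brk (b E3) (b U2) = 0" "brk (b U2) (b U2) = 0"
    "brk (b V2) (b E4) = 0" "brk (b V2) (b E3) = 0" "brk (b V2) (b U2) = 0" "brk (b V2) (b V2) = 0"
    by (rule trans[OF ex]; simp add: b_odd p_def q_def cubic_perm cubic_V2 cubic_values)+
qed

definition lincomb :: "complex ^ gen \<Rightarrow> 'a" where
  "lincomb x = (\<Sum>a\<in>UNIV. scl (x $ a) (b a))"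

lemma lincomb_bv [simp]: "lincomb (bv a) = b a"
  by (simp add: lincomb_def if_distrib[of "\<lambda>c. scl c _"] cong: if_cong)

lemma lincomb_linear: "Vector_Spaces.linear (*s) scl lincomb"
  unfolding Vector_Spaces.linear_iff
  by (simp add: vec.vector_space_axioms vector_space_axioms lincomb_def scale_left_distrib
      sum.distrib scale_sum_right)

lemma lincomb_graded: "x \<in> grading8 i \<Longrightarrow> lincomb x \<in> G i"
  using bit_cases[of i] b_even b_odd
  by (elim disjE; simp add: lincomb_def sum_gen even_iff odd_iff subspace_add subspace_scale subspace_G)

lemma form_lincomb: "B (lincomb x) (lincomb y) = form8 1 0 0 x y"
  by (simp only: lincomb_def form_sum_left form_scale_left)
    (simp add: form_sum_right form_scale_right b_form form8_def sum_distrib_left mult.assoc)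

text \<open>
  Injectivity comes from the form alone: \<open>lincomb\<close> carries the nondegenerate \<open>form8 1 0 0\<close> to \<open>B\<close>.
\<close>

lemma lincomb_bij: "bij lincomb"
proof (rule bijI)
  interpret l: Vector_Spaces.linear "(*s)" scl lincomb by (rule lincomb_linear)
  interpret std: odd_quadratic_lie_superalgebra "(*s)" grading8 "bracket8 0 0" "form8 1 0 0"
    by (rule bracket8_odd_quadratic) simp
  have "x = 0" if "lincomb x = 0" for x
    by (rule std.form_nondegenerate) (simp add: form_lincomb[symmetric] that)
  then show "inj lincomb"
    by (metis injI l.diff right_minus_eq)
  have "x \<in> range lincomb" for x
  proof -
    obtain y z where y: "y \<in> G 0" and z: "z \<in> G 1" and x: "x = y + z"
      using G_spanning by blast
    have b_range: "b a \<in> range lincomb" for a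
      by (rule image_eqI[of _ _ "bv a"]) simp_all
    have "y \<in> range lincomb"
      by (subst even_expansion[OF y])
        (intro subspace_diff subspace_add subspace_scale l.subspace_image vec.subspace_UNIV b_range)
    moreover have "z \<in> range lincomb"
      by (subst odd_expansion[OF z])
        (intro subspace_diff subspace_add subspace_scale l.subspace_image vec.subspace_UNIV b_range)
    ultimately show ?thesis
      unfolding x by (intro subspace_add l.subspace_image vec.subspace_UNIV)
  qed
  then show "surj lincomb" by auto
qed

lemma lincomb_brk: "lincomb (bracket8 p q x y) = brk (lincomb x) (lincomb y)"
proof (rule bilinear_gen_eqI[where s = scl and f = "\<lambda>x y. lincomb (bracket8 p q x y)"
      and g = "\<lambda>x y. brk (lincomb x) (lincomb y)"])
  interpret l: Vector_Spaces.linear "(*s)" scl lincomb by (rule lincomb_linear)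
  interpret F: lie_superalgebra "(*s)" grading8 "bracket8 p q" by (rule bracket8_superalgebra)
  show "Vector_Spaces.linear (*s) scl (\<lambda>x. lincomb (bracket8 p q x y))" for y
    using lincomb_linear by (simp add: Vector_Spaces.linear_iff F.brk_add_left F.brk_scale_left)
  show "Vector_Spaces.linear (*s) scl (\<lambda>y. lincomb (bracket8 p q x y))" for x
    using lincomb_linear by (simp add: Vector_Spaces.linear_iff F.brk_add_right F.brk_scale_right)
  show "Vector_Spaces.linear (*s) scl (\<lambda>x. brk (lincomb x) (lincomb y))" for y
    using lincomb_linear by (simp add: Vector_Spaces.linear_iff brk_add_left brk_scale_left)
  show "Vector_Spaces.linear (*s) scl (\<lambda>y. brk (lincomb x) (lincomb y))" for x
    using lincomb_linear by (simp add: Vector_Spaces.linear_iff brk_add_right brk_scale_right)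
  have comm: "brk (b E3) (b E4) = brk (b E4) (b E3)" "brk (b U2) (b E4) = brk (b E4) (b U2)"
    "brk (b U2) (b E3) = brk (b E3) (b U2)" "brk (b E4) (b V2) = brk (b V2) (b E4)"
    "brk (b E3) (b V2) = brk (b V2) (b E3)" "brk (b U2) (b V2) = brk (b V2) (b U2)"
    by (simp_all add: brk_odd_sym b_odd)
  have "\<forall>a c. lincomb (bracket8 p q (bv a) (bv c)) = brk (b a) (b c)"
    unfolding all_gen
    by (simp add: lincomb_def sum_gen bracket8_def b_rel brk_even_even brk_even_odd brk_odd_even
        brk_odd_odd comm)
  then show "lincomb (bracket8 p q (bv a) (bv c)) = brk (lincomb (bv a)) (lincomb (bv c))" for a c
    by simp
qed

text \<open>
  Surjectivity onto a graded part follows from bijectivity: the component of a preimage with the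
  wrong parity is mapped into \<open>G 0 \<inter> G 1\<close> and hence is zero.
\<close>

lemma bracket8_isomorphic: "lie_superalgebra_isomorphic (*s) grading8 (bracket8 p q) scl G brk"
proof -
  have "lincomb ` grading8 i = G i" for i
  proof
    show "lincomb ` grading8 i \<subseteq> G i" using lincomb_graded by blast
    show "G i \<subseteq> lincomb ` grading8 i"
    proof
      fix x assume x: "x \<in> G i"
      obtain v where v: "x = lincomb v" using lincomb_bij by (metis bij_pointE)
      interpret F: lie_superalgebra "(*s)" grading8 "bracket8 p q" by (rule bracket8_superalgebra)
      interpret l: Vector_Spaces.linear "(*s)" scl lincomb by (rule lincomb_linear)
      obtain v0 v1 where d: "v0 \<in> grading8 0" "v1 \<in> grading8 1" "v = v0 + v1"
        using F.G_spanning by blast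
      define w where "w = (if i = 0 then v1 else v0)"
      have w: "w \<in> grading8 (i + 1)" "v - w \<in> grading8 i"
        using bit_cases[of i] d by (auto simp: w_def)
      have "x - lincomb (v - w) \<in> G i" using x w(2) lincomb_graded subspace_diff subspace_G by blast
      moreover have "x - lincomb (v - w) = lincomb w" by (simp add: v l.diff)
      ultimately have "lincomb w \<in> G 0 \<inter> G 1"
        using lincomb_graded[OF w(1)] bit_cases[of i] by auto
      then have "lincomb w = 0" unfolding G_disjoint by simp
      then have "x = lincomb (v - w)" by (simp add: v l.diff)
      then show "x \<in> lincomb ` grading8 i" using w(2) by blast
    qed
  qed
  then show ?thesis
    unfolding lie_superalgebra_isomorphic_def lie_superalgebra_iso_def
    using lincomb_linear lincomb_bij lincomb_brk by blast
qed

end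

section \<open>From the flag to an adapted basis\<close>

text \<open>
  Here \<open>f1, f2\<close> span the two-dimensional member of the flag, \<open>f3\<close> completes them to the
  three-dimensional one, and \<open>x1, ..., x4\<close> is the dual basis. That brackets span the smaller members
  of the flag (and do not just lie in them) is recorded in dual form by the last two assumptions:
  a central vector of \<open>G 0\<close> annihilates \<open>f3\<close>, because \<open>f3\<close> is a combination of brackets, and
  bracketing with \<open>x1\<close> does not lead into the annihilator of \<open>f3\<close>, because \<open>x1\<close> does not
  annihilate \<open>f1\<close>, which is a combination of brackets with the three-dimensional member. The
  analogous property of \<open>x2\<close> is a consequence, so that \<open>x1\<close> and \<open>x2\<close> may be exchanged.
\<close>

locale adapted_dual_bases = odd_quadratic_lie_superalgebra scl G brk B
  for scl :: "complex \<Rightarrow> 'a::ab_group_add \<Rightarrow> 'a" and G brk B +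
  fixes x1 x2 x3 x4 f1 f2 f3 f4 :: 'a
  assumes even: "x1 \<in> G 0" "x2 \<in> G 0" "x3 \<in> G 0" "x4 \<in> G 0"
    and odd: "f1 \<in> G 1" "f2 \<in> G 1" "f3 \<in> G 1" "f4 \<in> G 1"
    and odd_span: "G 1 \<subseteq> span {f1, f2, f3, f4}"
    and dual:
      "B x1 f1 = 1" "B x1 f2 = 0" "B x1 f3 = 0" "B x1 f4 = 0"
      "B x2 f1 = 0" "B x2 f2 = 1" "B x2 f3 = 0" "B x2 f4 = 0"
      "B x3 f1 = 0" "B x3 f2 = 0" "B x3 f3 = 1" "B x3 f4 = 0"
      "B x4 f1 = 0" "B x4 f2 = 0" "B x4 f3 = 0" "B x4 f4 = 1"
    and kills_f1: "x \<in> G 0 \<Longrightarrow> brk x f1 = 0"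
    and kills_f2: "x \<in> G 0 \<Longrightarrow> brk x f2 = 0"
    and lowers_f3: "x \<in> G 0 \<Longrightarrow> brk x f3 \<in> span {f1, f2}"
    and lowers_f4: "x \<in> G 0 \<Longrightarrow> brk x f4 \<in> span {f1, f2, f3}"
    and centre_perp_f3: "x \<in> G 0 \<Longrightarrow> (\<And>y. y \<in> G 0 \<Longrightarrow> brk x y = 0) \<Longrightarrow> B x f3 = 0"
    and x1_moves: "\<exists>y\<in>G 0. B (brk x1 y) f3 \<noteq> 0"
begin

lemma even_eqI:
  assumes "x \<in> G 0" "y \<in> G 0"
    and "B x f1 = B y f1" "B x f2 = B y f2" "B x f3 = B y f3" "B x f4 = B y f4"
  shows "x = y"
proof -
  have "x - y = 0"
  proof (rule even_zeroI)
    show "x - y \<in> G 0" using assms(1,2) by (intro subspace_diff subspace_G)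
    show "B (x - y) z = 0" if "z \<in> G 1" for z
      by (rule form_zero_on_span[of "{f1, f2, f3, f4}"])
        (use that odd_span assms in \<open>auto simp: form_linear_simps\<close>)
  qed
  then show ?thesis by simp
qed

lemma even_expansion:
  "x \<in> G 0 \<Longrightarrow> x = scl (B x f1) x1 + scl (B x f2) x2 + scl (B x f3) x3 + scl (B x f4) x4"
  by (rule even_eqI)
    (auto simp: form_linear_simps dual intro!: subspace_add subspace_scale subspace_G even)

lemma even_closed: "x \<in> G 0 \<Longrightarrow> y \<in> G 0 \<Longrightarrow> brk x y \<in> G 0"
  using brk_graded[of x 0 y 0] by simp

lemma perp_span12: "y \<in> span {f1, f2} \<Longrightarrow> B x3 y = 0" "y \<in> span {f1, f2} \<Longrightarrow> B x4 y = 0"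
  by (rule form_zero_on_span[of "{f1, f2}"]; auto simp: dual)+

lemma perp_span123: "y \<in> span {f1, f2, f3} \<Longrightarrow> B x4 y = 0"
  by (rule form_zero_on_span[of "{f1, f2, f3}"]; auto simp: dual)+

definition "p = B (brk x1 x2) f3"
definition "q = B (brk x1 x2) f4"
definition "r = B (brk x1 x3) f4"
definition "s = B (brk x2 x3) f4"

lemma brk_perp_f12:
  assumes "x \<in> G 0" "y \<in> G 0" shows "B (brk x y) f1 = 0" "B (brk x y) f2 = 0"
  using assms by (simp_all add: form_invariant kills_f1 kills_f2)

lemma brk_x3_perp_f3:
  assumes "x \<in> G 0" shows "B (brk x x3) f3 = 0"
  using assms perp_span12(1)[OF lowers_f3[OF assms]] brk_even_skew[of x3 x 0] even
  by (simp add: form_invariant form_linear_simps)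

lemma x4_central:
  assumes "x \<in> G 0" shows "brk x x4 = 0"
proof (rule even_eqI)
  have "B (brk x x4) f = - B x4 (brk x f)" for f
    using assms brk_even_skew[of x4 x 0] even by (simp add: form_invariant form_linear_simps)
  then show "B (brk x x4) f3 = B 0 f3" "B (brk x x4) f4 = B 0 f4"
    using perp_span12(2)[OF lowers_f3[OF assms]] perp_span123[OF lowers_f4[OF assms]] by simp_all
qed (use assms even in \<open>auto simp: brk_perp_f12 even_closed subspace_0[OF subspace_G]\<close>)

text \<open>
  The structure constants of \<open>G 0\<close> are, up to sign, the matrix entries of its action on \<open>G 1\<close>. These
  matrices are strictly triangular with respect to the flag, which leaves four constants.
\<close>

lemma even_products:
  "brk x1 x2 = scl p x3 + scl q x4" "brk x1 x3 = scl r x4" "brk x2 x3 = scl s x4"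
  by (rule even_eqI; simp add: even even_closed brk_perp_f12 brk_x3_perp_f3 form_linear_simps dual
      p_def q_def r_def s_def subspace_add subspace_scale subspace_G)+

lemma even_products_skew:
  "brk x2 x1 = - (scl p x3 + scl q x4)" "brk x3 x1 = - scl r x4" "brk x3 x2 = - scl s x4"
  using brk_even_skew[of x1 x2 0] brk_even_skew[of x1 x3 0] brk_even_skew[of x2 x3 0] even_products even
  by simp_all

lemma p_nonzero: "p \<noteq> 0"
proof
  assume "p = 0"
  obtain y where y: "y \<in> G 0" "B (brk x1 y) f3 \<noteq> 0" using x1_moves by blast
  have "brk x1 y = brk x1 (scl (B y f1) x1 + scl (B y f2) x2 + scl (B y f3) x3 + scl (B y f4) x4)"
    using even_expansion[OF y(1)] by simp
  then have "B (brk x1 y) f3 = 0"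
    using \<open>p = 0\<close> even
    by (simp add: brk_add_right brk_scale_right brk_even_self even_products x4_central form_linear_simps dual)
  then show False using y(2) by simp
qed

lemma r_or_s_nonzero: "r \<noteq> 0 \<or> s \<noteq> 0"
proof (rule ccontr)
  assume "\<not> ?thesis"
  then have rs: "r = 0" "s = 0" by auto
  have "brk x3 y = 0" if "y \<in> G 0" for y
    by (subst even_expansion[OF that])
      (simp add: brk_add_right brk_scale_right even_products_skew rs x4_central even brk_even_self)
  then show False using centre_perp_f3[of x3] even dual by simp
qed

lemma swap_first_two: "adapted_dual_bases scl G brk B x2 x1 x3 x4 f2 f1 f3 f4"
proof
  show "\<exists>y\<in>G 0. B (brk x2 y) f3 \<noteq> 0"
    using p_nonzero by (intro bexI[of _ x1]) (simp_all add: even_products_skew form_linear_simps dual even)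
  show "G 1 \<subseteq> span {f2, f1, f3, f4}" using odd_span by (simp add: insert_commute)
qed (use even odd dual kills_f1 kills_f2 lowers_f3 lowers_f4 centre_perp_f3 in
    \<open>auto simp: insert_commute\<close>)

text \<open>
  Replacing $x_2$ by $x_2-(s/r)x_1$ makes it commute with $x_3$; then $[x_1,x_2]$ and
  $[x_1,[x_1,x_2]]$ serve as $X_3$ and $X_4$. The odd basis consists, up to sign, of the dual basis
  of this new even basis, which is obtained by the inverse transposed change of coordinates.
\<close>

lemma darboux_if_r_nonzero:
  assumes r: "r \<noteq> 0"
  shows "\<exists>b. darboux_filiform scl G brk B b"
proof -
  define t where "t = s / r"
  \<comment> \<open>Makes \<open>E4\<close> orthogonal to \<open>X3\<close>, which has the component \<open>q\<close> along \<open>x4\<close>.\<close>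
  define c where "c = q / (p\<^sup>2 * r)"
  define b where "b a = (case a of
      X1 \<Rightarrow> x1 | X2 \<Rightarrow> x2 - scl t x1 | X3 \<Rightarrow> scl p x3 + scl q x4 | X4 \<Rightarrow> scl (p * r) x4
    | E4 \<Rightarrow> scl c f3 - scl (1 / (p * r)) f4 | E3 \<Rightarrow> scl (1 / p) f3
    | U2 \<Rightarrow> - f2 | V2 \<Rightarrow> f1 + scl t f2)" for a
  have b_simps: "b X1 = x1" "b X2 = x2 - scl t x1" "b X3 = scl p x3 + scl q x4" "b X4 = scl (p * r) x4"
    "b E4 = scl c f3 - scl (1 / (p * r)) f4" "b E3 = scl (1 / p) f3" "b U2 = - f2" "b V2 = f1 + scl t f2"
    by (simp_all add: b_def)
  have "darboux_filiform scl G brk B b"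
  proof
    have "\<forall>a. b a \<in> G (parity a)"
      unfolding all_gen using even odd
      by (simp add: b_simps subspace_add subspace_scale subspace_diff subspace_neg subspace_G)
    then show "b a \<in> G (parity a)" for a ..
    note dual' = dual[unfolded form_commute[of x1] form_commute[of x2] form_commute[of x3]
        form_commute[of x4]]
    have pr: "p \<noteq> 0" "r \<noteq> 0" using p_nonzero r by auto
    have "\<forall>a c. B (b a) (b c) = form_value 1 0 0 a c"
      unfolding all_gen
      by (simp add: b_simps form_linear_simps odd form_odd[of _ 0] form_odd[of _ 1] even
          dual dual' form_value_def pr c_def power2_eq_square field_simps)
    then show "B (b a) (b c) = form_value 1 0 0 a c" for a c by blast
    show "G 1 \<subseteq> span {b E4, b E3, b U2, b V2}" (is "_ \<subseteq> span ?S")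
    proof -
      have base: "b E4 \<in> span ?S" "b E3 \<in> span ?S" "b U2 \<in> span ?S" "b V2 \<in> span ?S"
        by (auto intro: span_base)
      have "f1 = b V2 + scl t (b U2)" "f2 = - b U2" "f3 = scl p (b E3)"
        "f4 = scl (p * p * r * c) (b E3) - scl (p * r) (b E4)"
        using pr by (simp_all add: b_simps scale_right_diff_distrib)
      then have "{f1, f2, f3, f4} \<subseteq> span ?S"
        using base span_add span_diff span_neg span_scale by (metis empty_subsetI insert_subset)
      then show ?thesis using odd_span span_minimal subspace_span by (metis subset_trans)
    qed
    show "brk (b X1) (b X2) = b X3" "brk (b X1) (b X3) = b X4" "brk (b X2) (b X3) = 0"
      "brk (b X1) (b X4) = 0" "brk (b X2) (b X4) = 0" "brk (b X3) (b X4) = 0"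
      using pr
      by (simp_all add: b_simps t_def brk_add_left brk_add_right brk_diff_left brk_diff_right
          brk_scale_left brk_scale_right even brk_even_self even_products x4_central)
  qed
  then show ?thesis by (rule exI[of _ b])
qed

text \<open>
  One of \<open>r\<close> and \<open>s\<close> is nonzero, and exchanging \<open>x1\<close> with \<open>x2\<close> exchanges them.
\<close>

lemma darboux_exists: "\<exists>b. darboux_filiform scl G brk B b"
proof (cases "r = 0")
  case True
  interpret sw: adapted_dual_bases scl G brk B x2 x1 x3 x4 f2 f1 f3 f4 by (rule swap_first_two)
  have "sw.r \<noteq> 0" using True r_or_s_nonzero by (simp add: sw.r_def s_def)
  then show ?thesis by (rule sw.darboux_if_r_nonzero)
qed (rule darboux_if_r_nonzero)

end

locale odd_quadratic_weak_filiform8 =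
  odd_quadratic_lie_superalgebra scl G brk B + weak_filiform_lie_superalgebra scl G brk
  for scl :: "complex \<Rightarrow> 'a::ab_group_add \<Rightarrow> 'a" and G brk B +
  assumes dim8: "dim UNIV = 8"
begin

lemma dim_odd4: "dim (G 1) = 4"
  by (rule dim_odd_if_dim_8[OF odd_part_nontrivial dim8])

text \<open>
  The last two properties of adapted bases are proved by orthogonality: a vector whose brackets
  annihilate one member of the flag is itself orthogonal to the brackets with that member, and these
  span the next member.
\<close>

lemma adapted_dual_bases_exist:
  "\<exists>x1 x2 x3 x4 f1 f2 f3 f4. adapted_dual_bases scl G brk B x1 x2 x3 x4 f1 f2 f3 f4"
proof -
  obtain Bs where "finite_dimensional_vector_space scl Bs"
    using finite_dimensional_if_dim_pos unfolding dim8 by auto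
  then interpret fd: finite_dimensional_vector_space scl Bs .
  obtain V where V: "V 4 = G 1 \<and> V 1 = {0} \<and> (\<forall>i\<in>{2..4}.
      subspace (V i) \<and> dim (V i) = i \<and> V (i - 1) \<subset> V i \<and>
      span {brk x v |x v. x \<in> G 0 \<and> v \<in> V i} = V (i - 1))"
    by (rule exE[OF weak_filiform_flag[unfolded dim_odd4]]) (rule that)
  have steps: "(2::nat) \<in> {2..4}" "(3::nat) \<in> {2..4}" "(4::nat) \<in> {2..4}"
    "2 - 1 = (1::nat)" "3 - 1 = (2::nat)" "4 - 1 = (3::nat)" by simp_all
  note V4 = conjunct1[OF V] and V1 = conjunct1[OF conjunct2[OF V]]
    and Vi = bspec[OF conjunct2[OF conjunct2[OF V]]]
  note flag = Vi[OF steps(1), unfolded steps V1] Vi[OF steps(2), unfolded steps]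
    Vi[OF steps(3), unfolded steps V4]
  have sub: "subspace (V 2)" "subspace (V 3)" and d: "dim (V 2) = 2" "dim (V 3) = 3"
    and inc: "V 2 \<subset> V 3" "V 3 \<subset> G 1"
    and sp2: "span {brk x v |x v. x \<in> G 0 \<and> v \<in> V 2} = {0}"
    and sp3: "span {brk x v |x v. x \<in> G 0 \<and> v \<in> V 3} = V 2"
    and sp4: "span {brk x v |x v. x \<in> G 0 \<and> v \<in> G 1} = V 3"
    using flag by - (elim conjE, assumption)+
  obtain F where F: "F \<subseteq> V 2" "independent F" "V 2 \<subseteq> span F" "card F = 2"
    using basis_exists[of "V 2"] d(1) by metis
  obtain f1 f2 where f12: "F = {f1, f2}" "f1 \<noteq> f2" using F(4) by (auto simp: card_2_iff)
  have V2: "V 2 = span {f1, f2}"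
    using F(1,3) sub(1) span_minimal unfolding f12(1) by blast
  obtain f3 where f3: "f3 \<in> V 3" "f3 \<notin> V 2" using inc(1) by blast
  have ind3: "independent {f3, f1, f2}"
    using F(2) f3(2) unfolding V2 f12(1) by (rule independent_insertI[rotated])
  have card3: "card {f3, f1, f2} = 3"
  proof -
    have "f3 \<notin> {f1, f2}" using f3(2) F(1) f12(1) by blast
    then show ?thesis using f12(2) by simp
  qed
  have sub3: "{f3, f1, f2} \<subseteq> V 3" using f3(1) F(1) inc(1) unfolding f12(1) by blast
  have "V 3 \<subseteq> span {f3, f1, f2}"
    by (rule fd.card_ge_dim_independent[OF sub3 ind3]) (simp only: d card3 order_refl)
  then have V3: "V 3 = span {f3, f1, f2}"
    using span_minimal[OF sub3 sub(2)] by blast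
  obtain f4 where f4: "f4 \<in> G 1" "f4 \<notin> V 3" using inc(2) by blast
  have ind4: "independent {f4, f3, f1, f2}"
    using ind3 f4(2) unfolding V3 by (rule independent_insertI[rotated])
  have "f4 \<notin> {f3, f1, f2}" using f4(2) sub3 by blast
  then have card4: "card {f4, f3, f1, f2} = 4" using card3 by simp
  have sub4: "{f4, f3, f1, f2} \<subseteq> G 1" using f4(1) sub3 inc(2) by blast
  have G1: "G 1 \<subseteq> span {f4, f3, f1, f2}"
    by (rule fd.card_ge_dim_independent[OF sub4 ind4]) (simp only: dim_odd4 card4 order_refl)
  have fin: "finite {f4, f3, f1, f2}" by simp
  obtain x where xd: "\<forall>f\<in>{f4, f3, f1, f2}. x f \<in> G 0 \<and>
      (\<forall>f'\<in>{f4, f3, f1, f2}. B (x f) f' = (if f' = f then 1 else 0))"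
    by (rule exE[OF dual_family[OF fin ind4 sub4]]) (rule that)
  note x = conjunct1[OF bspec[OF xd]] and dual = bspec[OF conjunct2[OF bspec[OF xd]]]
  have distinct: "f1 \<noteq> f2" "f1 \<noteq> f3" "f1 \<noteq> f4" "f2 \<noteq> f3" "f2 \<noteq> f4" "f3 \<noteq> f4"
    using card4 by (auto simp: card_insert_if split: if_splits)
  have in2: "brk y v = 0" if "y \<in> G 0" "v \<in> V 2" for y v
    using that sp2 span_base[of "brk y v" "{brk x v |x v. x \<in> G 0 \<and> v \<in> V 2}"] by blast
  have in3: "brk y v \<in> V 2" if "y \<in> G 0" "v \<in> V 3" for y v
    using that sp3 span_base[of "brk y v" "{brk x v |x v. x \<in> G 0 \<and> v \<in> V 3}"] by blast
  have in4: "brk y v \<in> V 3" if "y \<in> G 0" "v \<in> G 1" for y v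
    using that sp4 span_base[of "brk y v" "{brk x v |x v. x \<in> G 0 \<and> v \<in> G 1}"] by blast
  have fV: "f1 \<in> V 2" "f2 \<in> V 2" using F(1) f12(1) by auto
  have "adapted_dual_bases scl G brk B (x f1) (x f2) (x f3) (x f4) f1 f2 f3 f4"
  proof
    show "x f1 \<in> G 0" "x f2 \<in> G 0" "x f3 \<in> G 0" "x f4 \<in> G 0" by (simp_all add: x)
    show "f1 \<in> G 1" "f2 \<in> G 1" "f3 \<in> G 1" "f4 \<in> G 1" using sub4 by auto
    show "G 1 \<subseteq> span {f1, f2, f3, f4}" using G1 by (simp add: insert_commute)
    show "brk y f1 = 0" "brk y f2 = 0" if "y \<in> G 0" for y using in2 that fV by auto
    show "brk y f3 \<in> span {f1, f2}" if "y \<in> G 0" for y using in3[OF that f3(1)] V2 by simp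
    show "brk y f4 \<in> span {f1, f2, f3}" if "y \<in> G 0" for y
      using in4[OF that f4(1)] V3 by (simp add: insert_commute)
    show "B y f3 = 0" if "y \<in> G 0" and c: "\<And>z. z \<in> G 0 \<Longrightarrow> brk y z = 0" for y
    proof (rule form_zero_on_span)
      show "f3 \<in> span {brk x v |x v. x \<in> G 0 \<and> v \<in> G 1}" using sp4 f3(1) by simp
    qed (auto simp: form_invariant[symmetric] c)
    show "\<exists>y\<in>G 0. B (brk (x f1) y) f3 \<noteq> 0"
    proof (rule ccontr)
      assume n: "\<not> ?thesis"
      have z: "B (brk (x f1) y) v = 0" if y: "y \<in> G 0" and v: "v \<in> V 3" for y v
      proof (rule form_zero_on_span)
        show "v \<in> span {f3, f1, f2}" using v V3 by simp
        show "B (brk (x f1) y) w = 0" if "w \<in> {f3, f1, f2}" for w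
          using that n y in2 fV by (auto simp: form_invariant)
      qed
      have "B (x f1) f1 = 0"
      proof (rule form_zero_on_span)
        show "f1 \<in> span {brk x v |x v. x \<in> G 0 \<and> v \<in> V 3}" using sp3 fV by simp
      qed (auto simp: form_invariant[symmetric] z)
      then show False by (simp add: dual)
    qed
  qed (simp_all add: dual distinct distinct[symmetric])
  then show ?thesis by blast
qed

lemma isomorphic_bracket8: "\<exists>p q. lie_superalgebra_isomorphic (*s) grading8 (bracket8 p q) scl G brk"
proof -
  obtain x1 x2 x3 x4 f1 f2 f3 f4 where "adapted_dual_bases scl G brk B x1 x2 x3 x4 f1 f2 f3 f4"
    using adapted_dual_bases_exist by blast
  then interpret a: adapted_dual_bases scl G brk B x1 x2 x3 x4 f1 f2 f3 f4 .
  obtain b where "darboux_filiform scl G brk B b" using a.darboux_exists by blast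
  then interpret d: darboux_filiform scl G brk B b .
  show ?thesis using d.bracket8_isomorphic by blast
qed

end

section \<open>Normalising the parameters\<close>

lemma lie_superalgebra_isomorphic_trans:
  assumes "lie_superalgebra_isomorphic s G m s' G' m'"
    and "lie_superalgebra_isomorphic s' G' m' s'' G'' m''"
  shows "lie_superalgebra_isomorphic s G m s'' G'' m''"
proof -
  obtain f g where f: "lie_superalgebra_iso s G m s' G' m' f"
    and g: "lie_superalgebra_iso s' G' m' s'' G'' m'' g"
    using assms by (auto simp: lie_superalgebra_isomorphic_def)
  have "Vector_Spaces.linear s s'' (g \<circ> f)"
    using f g Vector_Spaces.linear_compose[of s s' f s'' g] by (simp add: lie_superalgebra_iso_def)
  moreover have "bij (g \<circ> f)"
    using f g bij_comp[of f g] by (simp add: lie_superalgebra_iso_def)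
  moreover have "(g \<circ> f) ` G i = G'' i" for i
    using f g by (simp only: lie_superalgebra_iso_def image_comp[symmetric])
  moreover have "(g \<circ> f) (m x y) = m'' ((g \<circ> f) x) ((g \<circ> f) y)" for x y
    using f g by (simp add: lie_superalgebra_iso_def)
  ultimately have "lie_superalgebra_iso s G m s'' G'' m'' (g \<circ> f)"
    unfolding lie_superalgebra_iso_def by simp
  then show ?thesis unfolding lie_superalgebra_isomorphic_def by blast
qed

lemma lie_superalgebra_isomorphic_refl:
  assumes "lie_superalgebra s G m"
  shows "lie_superalgebra_isomorphic s G m s G m"
proof -
  interpret lie_superalgebra s G m by fact
  have "lie_superalgebra_iso s G m s G m id"
    unfolding lie_superalgebra_iso_def Vector_Spaces.linear_iff
    by (simp add: vector_space_axioms)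
  then show ?thesis unfolding lie_superalgebra_isomorphic_def by blast
qed

lemma bracket8_classification:
  "\<exists>m\<in>{g80, g81, g82}. lie_superalgebra_isomorphic (*s) grading8 m (*s) grading8 (bracket8 p q)"
proof -
  consider "q \<noteq> 0" | "q = 0" "p \<noteq> 0" | "q = 0" "p = 0" by blast
  then show ?thesis
  proof cases
    case 1
    have "lie_superalgebra_isomorphic (*s) grading8 g82 (*s) grading8 (bracket8 p q)"
      using shear_iso[OF 1, of 0 1 p] by (simp add: g82_eq_bracket8)
    then show ?thesis by blast
  next
    case 2
    have "lie_superalgebra_isomorphic (*s) grading8 g81 (*s) grading8 (bracket8 p q)"
      using shear_iso[OF 2(2), of 1 0 0] by (simp add: g81_eq_bracket8 2(1))
    then show ?thesis by blast
  next
    case 3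
    have "lie_superalgebra_isomorphic (*s) grading8 g80 (*s) grading8 (bracket8 p q)"
      unfolding g80_eq_bracket8 3 by (rule lie_superalgebra_isomorphic_refl[OF bracket8_superalgebra])
    then show ?thesis by blast
  qed
qed

section \<open>The invariant forms\<close>

lemma odd_quadratic_pullback:
  assumes "odd_quadratic_lie_superalgebra s' G' m' B" "lie_superalgebra s G m"
    and "lie_superalgebra_iso s G m s' G' m' f"
  shows "odd_quadratic_lie_superalgebra s G m (\<lambda>x y. B (f x) (f y))"
proof -
  interpret t: odd_quadratic_lie_superalgebra s' G' m' B by fact
  interpret lie_superalgebra s G m by fact
  have lin: "Vector_Spaces.linear s s' f" and bij: "bij f" and img: "\<And>i. f ` G i = G' i"
    and brk: "\<And>x y. f (m x y) = m' (f x) (f y)"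
    using assms(3) by (auto simp: lie_superalgebra_iso_def)
  have f0: "f 0 = 0" using module_hom.zero[OF Vector_Spaces.linear.axioms(3)[OF lin]] .
  have fG: "f x \<in> G' i" if "x \<in> G i" for x i using that img by blast
  show ?thesis
  proof (intro odd_quadratic_lie_superalgebra.intro odd_quadratic_lie_superalgebra_axioms.intro
      lie_superalgebra_axioms)
    show "Vector_Spaces.linear s (*) (\<lambda>x. B (f x) (f y))" for y
      using Vector_Spaces.linear_compose[OF lin t.form_linear_left[of "f y"]] by (simp add: o_def)
    show "Vector_Spaces.linear s (*) (\<lambda>y. B (f x) (f y))" for x
      using Vector_Spaces.linear_compose[OF lin t.form_linear_right[of "f x"]] by (simp add: o_def)
    show "B (f x) (f y) = koszul i j * B (f y) (f x)" if "x \<in> G i" "y \<in> G j" for x y i j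
      using that fG t.form_supersymmetric by blast
    show "B (f (m x y)) (f z) = B (f x) (f (m y z))" for x y z
      by (simp add: brk t.form_invariant)
    show "B (f x) (f y) = 0" if "x \<in> G i" "y \<in> G i" for x y i
      using that fG t.form_odd by blast
    show "x = 0" if "\<And>y. B (f x) (f y) = 0" for x
    proof -
      have "B (f x) y = 0" for y
        using that[of "inv f y"] bij by (simp add: bij_is_surj surj_f_inv_f)
      then have "f x = f 0" by (simp add: t.form_nondegenerate f0)
      then show "x = 0" using bij by (simp add: bij_is_inj inj_eq)
    qed
  qed
qed

text \<open>
  Writing $X_3,X_4,e_3,u_2,v_2$ as brackets with $X_1$ and $X_2$ and moving brackets across the form
  expresses every value by those at $(X_1,v_2)$, $(X_1,e_4)$ and $(X_2,e_4)$. The first value is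
  nonzero because otherwise $v_2$ would lie in the radical.
\<close>

lemma bracket8_forms:
  assumes "odd_quadratic_lie_superalgebra (*s) grading8 (bracket8 p q) B"
  shows "\<exists>lam \<alpha> \<beta>. lam \<noteq> 0 \<and> (\<forall>x y. B x y = form8 lam \<alpha> \<beta> x y)"
proof -
  interpret odd_quadratic_lie_superalgebra "(*s)" grading8 "bracket8 p q" B by fact
  define lam \<alpha> \<beta> where "lam = B (bv X1) (bv V2)" and "\<alpha> = B (bv X1) (bv E4)"
    and "\<beta> = B (bv X2) (bv E4)"
  have gens: "bv X3 = bracket8 p q (bv X1) (bv X2)" "bv X4 = bracket8 p q (bv X1) (bv X3)"
    "bv E3 = bracket8 p q (bv X1) (bv E4)" "bv U2 = bracket8 p q (bv X1) (bv E3)"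
    "bv V2 = bracket8 p q (bv X2) (bv E3)"
    and products: "bracket8 p q (bv X1) (bv X1) = 0" "bracket8 p q (bv X2) (bv X2) = 0"
      "bracket8 p q (bv X2) (bv X1) = - bv X3" "bracket8 p q (bv X2) (bv E4) = 0"
      "bracket8 p q (bv X2) (bv U2) = 0" "bracket8 p q (bv X2) (bv V2) = 0"
      "bracket8 p q (bv X3) (bv E4) = - bv V2" "bracket8 p q (bv X3) (bv E3) = 0"
      "bracket8 p q (bv X3) (bv U2) = 0" "bracket8 p q (bv X3) (bv V2) = 0"
    by (simp_all add: bracket8_def vec_eq_gen)
  have x3: "B (bv X3) z = B (bv X1) (bracket8 p q (bv X2) z)" for z
    by (subst gens(1)) (rule form_invariant)
  have x4: "B (bv X4) z = B (bv X1) (bracket8 p q (bv X3) z)" for z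
    by (subst gens(2)) (rule form_invariant)
  have e3: "B z (bv E3) = B (bracket8 p q z (bv X1)) (bv E4)" for z
    by (subst gens(3)) (rule form_invariant[symmetric])
  have u2: "B z (bv U2) = B (bracket8 p q z (bv X1)) (bv E3)" for z
    by (subst gens(4)) (rule form_invariant[symmetric])
  have v2: "B z (bv V2) = B (bracket8 p q z (bv X2)) (bv E3)" for z
    by (subst gens(5)) (rule form_invariant[symmetric])
  have r3: "B (bv X3) (bv E4) = 0" "B (bv X3) (bv E3) = lam" "B (bv X3) (bv U2) = 0"
    "B (bv X3) (bv V2) = 0"
    unfolding x3 products gens(5)[symmetric] by (simp_all add: lam_def)
  have r4: "B (bv X4) (bv E4) = - lam" "B (bv X4) (bv E3) = 0" "B (bv X4) (bv U2) = 0"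
    "B (bv X4) (bv V2) = 0"
    unfolding x4 products by (simp_all add: lam_def form_minus_right)
  have r1: "B (bv X1) (bv E3) = 0" "B (bv X1) (bv U2) = 0"
    unfolding e3[of "bv X1"] u2[of "bv X1"] products by simp_all
  have r2: "B (bv X2) (bv E3) = 0" "B (bv X2) (bv U2) = - lam" "B (bv X2) (bv V2) = 0"
    unfolding e3[of "bv X2"] u2[of "bv X2"] v2[of "bv X2"] products by (simp_all add: form_minus_left r3)
  have same: "B (bv a) (bv c) = 0" if "parity a = parity c" for a c
    using form_odd bv_graded that by metis
  note rows = lam_def[symmetric] \<alpha>_def[symmetric] \<beta>_def[symmetric] r1 r2 r3 r4
  note cols = rows[unfolded form_commute[of "bv X1"] form_commute[of "bv X2"]
      form_commute[of "bv X3"] form_commute[of "bv X4"]]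
  have on_basis: "\<forall>a c. B (bv a) (bv c) = form8 lam \<alpha> \<beta> (bv a) (bv c)"
    unfolding all_gen
    by (simp add: same form8_gen rows cols)
  have B: "B x y = form8 lam \<alpha> \<beta> x y" for x y
    by (rule bilinear_gen_eqI[where f = B and g = "form8 lam \<alpha> \<beta>" and s = "(*)",
          OF form_linear_left form_linear_right form8_linear])
      (use on_basis in blast)
  have "lam \<noteq> 0"
  proof
    assume "lam = 0"
    then have "bv V2 = 0"
      by (intro form_nondegenerate) (simp add: B form8_gen)
    then show False by (simp add: vec_eq_gen)
  qed
  with B show ?thesis by blast
qed

section \<open>The flag of the model algebras\<close>

lemma dim_coordinate_subspace:
  fixes W :: "(complex ^ gen) set"
  assumes "\<And>v. v \<in> W \<longleftrightarrow> (\<forall>a. a \<notin> S \<longrightarrow> v $ a = 0)"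
  shows "vec.dim W = card S"
proof (rule vec.dim_unique)
  show "bv ` S \<subseteq> W" using assms by auto
  show "W \<subseteq> vec.span (bv ` S)"
  proof
    fix v assume "v \<in> W"
    then have "v = (\<Sum>a\<in>S. v $ a *s bv a)"
      using assms by (auto simp: vec_eq_iff if_distrib cong: if_cong)
    also have "\<dots> \<in> vec.span (bv ` S)"
      by (intro vec.span_sum vec.span_scale vec.span_base) auto
    finally show "v \<in> vec.span (bv ` S)" .
  qed
  have "bv ` S \<subseteq> cart_basis" by (auto simp: cart_basis_def)
  then show "vec.independent (bv ` S)"
    using vec.independent_Basis vec.independent_mono by blast
  show "card (bv ` S) = card S"
    by (rule card_image) (auto simp: inj_on_def axis_eq_axis)
qed

text \<open>
  The flag consists of the coordinate subspaces obtained by dropping $e_4$, then $e_3$, then both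
  $u_2$ and $v_2$. The last drop is by two dimensions: the even part kills both $u_2$ and $v_2$,
  while it reaches them from $e_3$ by $X_1$ and $X_2$.
\<close>

lemma bracket8_weak_filiform: "weak_filiform_lie_superalgebra (*s) grading8 (bracket8 p q)"
proof -
  interpret lie_superalgebra "(*s)" grading8 "bracket8 p q" by (rule bracket8_superalgebra)
  have dim4: "vec.dim (grading8 1) = 4"
    using dim_coordinate_subspace[of "grading8 1" "{E4, E3, U2, V2}"]
    by (simp add: odd_iff all_gen)
  define V where "V i = {v \<in> grading8 1. (i < 4 \<longrightarrow> v $ E4 = 0) \<and> (i < 3 \<longrightarrow> v $ E3 = 0) \<and>
    (i < 2 \<longrightarrow> v = 0)}" for i :: nat
  have dim3: "vec.dim (V 3) = 3"
  proof -
    have "v \<in> V 3 \<longleftrightarrow> (\<forall>a. a \<notin> {E3, U2, V2} \<longrightarrow> v $ a = 0)" for v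
      by (auto simp: V_def odd_iff all_gen)
    from dim_coordinate_subspace[OF this] show ?thesis by simp
  qed
  have dim2: "vec.dim (V 2) = 2"
  proof -
    have "v \<in> V 2 \<longleftrightarrow> (\<forall>a. a \<notin> {U2, V2} \<longrightarrow> v $ a = 0)" for v
      by (auto simp: V_def odd_iff all_gen)
    from dim_coordinate_subspace[OF this] show ?thesis by simp
  qed
  have V4: "V 4 = grading8 1" and V1: "V 1 = {0}"
    by (auto simp: V_def odd_iff)
  have sub: "vec.subspace (V i)" for i
    by (rule vec.subspaceI) (simp_all add: V_def odd_iff)
  let ?S = "\<lambda>i. {bracket8 p q x v |x v. x \<in> grading8 0 \<and> v \<in> V i}"
  have le: "vec.span (?S i) \<subseteq> V (i - 1)" if "i \<in> {2, 3, 4}" for i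
  proof (rule vec.span_minimal[OF _ sub])
    have "bracket8 p q x v \<in> V (i - 1)" if "x \<in> grading8 0" "v \<in> V i" for x v
      using that \<open>i \<in> {2, 3, 4}\<close>
      by (elim insertE emptyE; simp add: V_def odd_iff even_iff bracket8_def vec_eq_gen)
    then show "?S i \<subseteq> V (i - 1)" by blast
  qed
  have gen: "bracket8 p q x v \<in> vec.span (?S i)" if "x \<in> grading8 0" "v \<in> V i" for x v i
    using that by (intro vec.span_base) blast
  have ge: "V (i - 1) \<subseteq> vec.span (?S i)" if i: "i \<in> {2, 3, 4}" for i
  proof
    fix v assume v: "v \<in> V (i - 1)"
    have "v = bracket8 p q (bv X1) (v $ E3 *s bv E4 + v $ U2 *s bv E3)
        + bracket8 p q (bv X2) (v $ V2 *s bv E3)"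
      using i v by (elim insertE emptyE; simp add: V_def odd_iff bracket8_def vec_eq_gen)
    also have "\<dots> \<in> vec.span (?S i)"
      by (intro vec.span_add gen) (use v i in \<open>auto simp: V_def odd_iff even_iff\<close>)
    finally show "v \<in> vec.span (?S i)" .
  qed
  have less: "V (i - 1) \<subset> V i" if "i \<in> {2, 3, 4}" for i
  proof -
    have "V (i - 1) \<subseteq> V i" using that by (auto simp: V_def)
    moreover have "bv (if i = 2 then U2 else if i = 3 then E3 else E4) \<in> V i - V (i - 1)"
      using that by (auto simp: V_def odd_iff vec_eq_gen)
    ultimately show ?thesis by blast
  qed
  have "\<forall>i\<in>{2..4}. vec.subspace (V i) \<and> vec.dim (V i) = i \<and> V (i - 1) \<subset> V i \<and>
      vec.span (?S i) = V (i - 1)"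
  proof
    fix i :: nat assume "i \<in> {2..4}"
    then have i: "i \<in> {2, 3, 4}" by auto
    then have "vec.dim (V i) = i" using dim2 dim3 dim4 V4 by auto
    moreover have "vec.span (?S i) = V (i - 1)" using le[OF i] ge[OF i] by (rule equalityI)
    ultimately show "vec.subspace (V i) \<and> vec.dim (V i) = i \<and> V (i - 1) \<subset> V i \<and>
      vec.span (?S i) = V (i - 1)"
      using sub less[OF i] by blast
  qed
  then have "V (vec.dim (grading8 1)) = grading8 1 \<and> V 1 = {0} \<and>
      (\<forall>i\<in>{2..vec.dim (grading8 1)}. vec.subspace (V i) \<and> vec.dim (V i) = i \<and> V (i - 1) \<subset> V i \<and>
        vec.span (?S i) = V (i - 1))"
    unfolding dim4 using V4 V1 by blast
  moreover have "vec.dim (grading8 1) > 0" unfolding dim4 by simp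
  ultimately show ?thesis
    by (intro weak_filiform_lie_superalgebra.intro weak_filiform_lie_superalgebra_axioms.intro
        lie_superalgebra_axioms) (assumption, rule exI[of _ V], assumption)
qed

section \<open>Non-isomorphism and the classification\<close>

lemma odd_abelian_not_isomorphic:
  assumes "p \<noteq> 0 \<or> q \<noteq> 0"
  shows "\<not> lie_superalgebra_isomorphic (*s) grading8 (bracket8 0 0) (*s) grading8 (bracket8 p q)"
proof
  assume "lie_superalgebra_isomorphic (*s) grading8 (bracket8 0 0) (*s) grading8 (bracket8 p q)"
  then obtain f where f: "Vector_Spaces.linear (*s) (*s) f" "f ` grading8 1 = grading8 1"
    "\<And>x y. f (bracket8 0 0 x y) = bracket8 p q (f x) (f y)"
    unfolding lie_superalgebra_isomorphic_def lie_superalgebra_iso_def by blast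
  interpret Vector_Spaces.linear "(*s)" "(*s)" f by (rule f(1))
  have "bv E4 \<in> f ` grading8 1" unfolding f(2) by (simp add: odd_iff)
  then obtain x where x: "x \<in> grading8 1" "f x = bv E4" by force
  have "bracket8 0 0 x x = 0" using x(1) by (simp add: odd_iff bracket8_def vec_eq_gen)
  then have "bracket8 p q (bv E4) (bv E4) = 0"
    using f(3)[of x x] x(2) by (simp add: zero)
  then show False using assms by (simp add: bracket8_def vec_eq_gen)
qed

text \<open>
  If the second parameter vanishes, all products of odd vectors are multiples of the central vector
  $X_4$; otherwise $[X_1,[e_4,e_4]]=qX_3$ is nonzero.
\<close>

lemma central_square_not_isomorphic:
  assumes "q \<noteq> 0"
  shows "\<not> lie_superalgebra_isomorphic (*s) grading8 (bracket8 p' 0) (*s) grading8 (bracket8 p q)"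
proof
  assume "lie_superalgebra_isomorphic (*s) grading8 (bracket8 p' 0) (*s) grading8 (bracket8 p q)"
  then obtain f where lin: "Vector_Spaces.linear (*s) (*s) f" and bij: "bij f"
    and odd: "f ` grading8 1 = grading8 1"
    and brk: "\<And>x y. f (bracket8 p' 0 x y) = bracket8 p q (f x) (f y)"
    unfolding lie_superalgebra_isomorphic_def lie_superalgebra_iso_def by blast
  interpret Vector_Spaces.linear "(*s)" "(*s)" f by fact
  have "bv E4 \<in> f ` grading8 1" unfolding odd by (simp add: odd_iff)
  then obtain x where x: "x \<in> grading8 1" "f x = bv E4" by force
  obtain z where z: "f z = bv X1" using surjE[OF bij_is_surj[OF bij]] by metis
  have "bracket8 p' 0 z (bracket8 p' 0 x x) = 0" using x(1) by (simp add: odd_iff bracket8_def vec_eq_gen)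
  then have "bracket8 p q (bv X1) (bracket8 p q (bv E4) (bv E4)) = 0"
    using brk[of z "bracket8 p' 0 x x"] brk[of x x] x(2) z by (simp add: zero)
  then show False using assms by (simp add: bracket8_def vec_eq_gen)
qed

theorem theorem4p3:
  shows
    "(\<forall>(scl :: complex \<Rightarrow> 'a::ab_group_add \<Rightarrow> 'a) G brk B.
        odd_quadratic_lie_superalgebra scl G brk B \<and>
        weak_filiform_lie_superalgebra scl G brk \<and>
        vector_space.dim scl UNIV = 8 \<longrightarrow>
          (\<exists>m\<in>{g80, g81, g82}. lie_superalgebra_isomorphic (*s) grading8 m scl G brk) \<and>
          (\<forall>m\<in>{g80, g81, g82}. \<forall>f. lie_superalgebra_iso (*s) grading8 m scl G brk f \<longrightarrow>
             (\<exists>lam \<alpha> \<beta>. lam \<noteq> 0 \<and> (\<forall>x y. B (f x) (f y) = form8 lam \<alpha> \<beta> x y))))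
     \<and> \<not> lie_superalgebra_isomorphic (*s) grading8 g80 (*s) grading8 g81
     \<and> \<not> lie_superalgebra_isomorphic (*s) grading8 g80 (*s) grading8 g82
     \<and> \<not> lie_superalgebra_isomorphic (*s) grading8 g81 (*s) grading8 g82
     \<and> (\<forall>m\<in>{g80, g81, g82}.
          weak_filiform_lie_superalgebra (*s) grading8 m \<and>
          (\<forall>lam \<alpha> \<beta>. lam \<noteq> 0 \<longrightarrow>
             odd_quadratic_lie_superalgebra (*s) grading8 m (form8 lam \<alpha> \<beta>)))"
proof (intro conjI allI impI; (elim conjE)?)
  fix scl :: "complex \<Rightarrow> 'a \<Rightarrow> 'a" and G brk B
  assume Q: "odd_quadratic_lie_superalgebra scl G brk B"
    and "weak_filiform_lie_superalgebra scl G brk" "vector_space.dim scl UNIV = 8"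
  then interpret odd_quadratic_weak_filiform8 scl G brk B
    by (intro odd_quadratic_weak_filiform8.intro odd_quadratic_weak_filiform8_axioms.intro)
  show "\<exists>m\<in>{g80, g81, g82}. lie_superalgebra_isomorphic (*s) grading8 m scl G brk"
    using isomorphic_bracket8 bracket8_classification lie_superalgebra_isomorphic_trans by metis
  show "\<forall>m\<in>{g80, g81, g82}. \<forall>f. lie_superalgebra_iso (*s) grading8 m scl G brk f \<longrightarrow>
             (\<exists>lam \<alpha> \<beta>. lam \<noteq> 0 \<and> (\<forall>x y. B (f x) (f y) = form8 lam \<alpha> \<beta> x y))"
    using bracket8_forms[OF odd_quadratic_pullback[OF Q bracket8_superalgebra]]
    by (auto simp: g80_eq_bracket8 g81_eq_bracket8 g82_eq_bracket8)
qed (auto simp: g80_eq_bracket8 g81_eq_bracket8 g82_eq_bracket8 odd_abelian_not_isomorphic central_square_not_isomorphic bracket8_weak_filiform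
    bracket8_odd_quadratic)

end
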